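(* Let $N$ be an $A$-definable subgroup of $G$ (not necessarily normal), with inclusion $\iota:N\to G$ and projection $\pi:G\to G/N$ onto the left-coset space. Then the sequence $$1\to H^{0}_{\mathrm{def}}(\mathcal G,N)\xrightarrow{\iota^0}H^0_{\mathrm{def}}(\mathcal G,G)\xrightarrow{\pi^0} H^0_{\mathrm{def}}(\mathcal G,G/N)\xrightarrow{\delta}H^1_{\mathrm{def}}(\mathcal G,N)\xrightarrow{\iota^1} H^{1}_{\mathrm{def}}(\mathcal G,G)$$ is exact as a sequence of pointed sets. Furthermore, if $N$ is normal in $G$, then the sequence remains exact when extended by $$H^{1}_{\mathrm{def}}(\mathcal G,G)\xrightarrow{\pi^1}H^1_{\mathrm{def}}(\mathcal G,G/N).$$
   Context: Setting. Fix a first-order structure $M$ and a subset $A$ of $M$ such that: (i) $M$ is atomic over $A$, i.e. for every finite tuple $a$ from $M$ the type $\mathrm{tp}(a/A)$ is isolated; (ii) for all finite tuples $a,b$ from $M$ with $\mathrm{tp}(a/A)=\mathrm{tp}(b/A)$ there is $\sigma\in\mathrm{Aut}(M/A)$ with $\sigma(a)=b$; (iii) the theory of $M$ eliminates imaginaries (so quotients such as $G/N$ are identified with $A$-definable sets). Put $\mathcal G=\mathrm{Aut}(M/A)$. $G$ is an arbitrary group definable in $M$ with parameters from $A$; $\mathcal G$ acts on $G$ by group automorphisms. "$A$-definable" means definable in $M$ with parameters from $A$. Tuples are finite. For an $A$-definable set $X$, $H^0_{\mathrm{def}}(\mathcal G,X)$ is the set of $\mathcal G$-invariant points of $X$; it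 is pointed if $X$ has a $\mathcal G$-invariant distinguished point. Groups are pointed by the identity and $G/N$ by the coset $N$. For an $A$-definable group $G$, a definable cocycle from $\mathcal G$ to $G$ is a map $\Phi:\mathcal G\to G$ with $\Phi(\sigma_1\sigma_2)=\Phi(\sigma_1)\cdot\sigma_1(\Phi(\sigma_2))$ for which there are a tuple $a$ from $M$ and an $A$-definable (partial) function $h(x,y)$ with $\Phi(\sigma)=h(a,\sigma(a))$ for all $\sigma\in\mathcal G$. The set of these is $Z^1_{\mathrm{def}}(\mathcal G,G)$. $\Phi$ and $\Psi$ are cohomologous if there is $b\in G$ with $\Psi(\sigma)=b^{-1}\Phi(\sigma)\sigma(b)$ for all $\sigma$. $H^1_{\mathrm{def}}(\mathcal G,G)$ is the set of equivalence classes, pointed by the class of the trivial cocycle. Maps. An $A$-definable map $f:X\to X'$ induces $f^0:H^0_{\mathrm{def}}(\mathcal G,X)\to H^0_{\mathrm{def}}(\mathcal G,X')$ by restriction. An $A$-definable group homomorphism $f:G\to G'$ induces $f^1:H^1_{\mathrm{def}}(\mathcal G,G)\to H^1_{\mathrm{def}}(\mathcal G,G')$, $[\Phi]\mapsto[f\circ\Phi]$. The connecting map $\delta:H^0_{\mathrm{def}}(\mathcal G,G/N)\to H^1_{\mathrm{def}}(\mathcal G,N)$ sends $a=\pi(b)$ (with $b\in G$) to the class of the cocycle $\sigma\mapsto b^{-1}\sigma(b)$, which takes values in $N$; the class does not depend on the choice of $b$. A sequence of pointed sets is exact at a term if the image of the incoming map equals the preimage of the distinguished element under the outgoing map. *)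

theory Defs
  imports "HOL-Algebra.Coset" "HOL-Combinatorics.Permutations"
begin

section \<open>First-order structures\<close>

text \<open>
  A language is given by sets of function and relation symbols tagged with their arities; these
  may be empty although the types of symbols are not. Tuples are lists, so the interpretations
  only matter on lists over the universe of the right length.
\<close>

record ('f, 'r, 'm) fo_structure =
  univ :: "'m set"
  funs :: "('f \<times> nat) set"
  rels :: "('r \<times> nat) set"
  fint :: "'f \<Rightarrow> 'm list \<Rightarrow> 'm"
  rint :: "'r \<Rightarrow> 'm list \<Rightarrow> bool"

definition tuples :: "'m set \<Rightarrow> nat \<Rightarrow> 'm list set" where
  "tuples S n = {x. length x = n \<and> set x \<subseteq> S}"

definition is_structure :: "('f, 'r, 'm) fo_structure \<Rightarrow> bool" where
  "is_structure M \<longleftrightarrow> univ M \<noteq> {} \<and>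
     (\<forall>(f, n) \<in> funs M. \<forall>x \<in> tuples (univ M) n. fint M f x \<in> univ M)"

datatype 'f trm = Var nat | App 'f "'f trm list"

datatype ('f, 'r) fm =
    Eq "'f trm" "'f trm"
  | Rel 'r "'f trm list"
  | Neg "('f, 'r) fm"
  | And "('f, 'r) fm" "('f, 'r) fm"
  | Ex nat "('f, 'r) fm"

primrec tvars :: "'f trm \<Rightarrow> nat set" where
  "tvars (Var i) = {i}"
| "tvars (App f ts) = \<Union> (set (map tvars ts))"

primrec fvars :: "('f, 'r) fm \<Rightarrow> nat set" where
  "fvars (Eq s t) = tvars s \<union> tvars t"
| "fvars (Rel r ts) = \<Union> (set (map tvars ts))"
| "fvars (Neg \<phi>) = fvars \<phi>"
| "fvars (And \<phi> \<psi>) = fvars \<phi> \<union> fvars \<psi>"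
| "fvars (Ex i \<phi>) = fvars \<phi> - {i}"

fun trm_in :: "('f, 'r, 'm) fo_structure \<Rightarrow> 'f trm \<Rightarrow> bool" where
  "trm_in M (Var i) \<longleftrightarrow> True"
| "trm_in M (App f ts) \<longleftrightarrow> (f, length ts) \<in> funs M \<and> (\<forall>t \<in> set ts. trm_in M t)"

primrec fm_in :: "('f, 'r, 'm) fo_structure \<Rightarrow> ('f, 'r) fm \<Rightarrow> bool" where
  "fm_in M (Eq s t) \<longleftrightarrow> trm_in M s \<and> trm_in M t"
| "fm_in M (Rel r ts) \<longleftrightarrow> (r, length ts) \<in> rels M \<and> (\<forall>t \<in> set ts. trm_in M t)"
| "fm_in M (Neg \<phi>) \<longleftrightarrow> fm_in M \<phi>"
| "fm_in M (And \<phi> \<psi>) \<longleftrightarrow> fm_in M \<phi> \<and> fm_in M \<psi>"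
| "fm_in M (Ex i \<phi>) \<longleftrightarrow> fm_in M \<phi>"

primrec eval_trm :: "('f, 'r, 'm) fo_structure \<Rightarrow> (nat \<Rightarrow> 'm) \<Rightarrow> 'f trm \<Rightarrow> 'm" where
  "eval_trm M e (Var i) = e i"
| "eval_trm M e (App f ts) = fint M f (map (eval_trm M e) ts)"

primrec sat :: "('f, 'r, 'm) fo_structure \<Rightarrow> (nat \<Rightarrow> 'm) \<Rightarrow> ('f, 'r) fm \<Rightarrow> bool" where
  "sat M e (Eq s t) \<longleftrightarrow> eval_trm M e s = eval_trm M e t"
| "sat M e (Rel r ts) \<longleftrightarrow> rint M r (map (eval_trm M e) ts)"
| "sat M e (Neg \<phi>) \<longleftrightarrow> \<not> sat M e \<phi>"
| "sat M e (And \<phi> \<psi>) \<longleftrightarrow> sat M e \<phi> \<and> sat M e \<psi>"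
| "sat M e (Ex i \<phi>) \<longleftrightarrow> (\<exists>m \<in> univ M. sat M (e(i := m)) \<phi>)"

section \<open>Definability, types, automorphisms\<close>

text \<open>
  A formula \<open>\<phi>(x\<^sub>0,\<dots>,x\<^sub>n\<^sub>-\<^sub>1; c)\<close> with parameters from \<open>A\<close> is encoded as a pair \<open>(\<phi>, c)\<close>: the
  variables below \<open>n\<close> are the object variables, the following \<open>length c\<close> ones stand for the
  parameters \<open>c\<close>.
\<close>

definition param_fms ::
  "('f, 'r, 'm) fo_structure \<Rightarrow> 'm set \<Rightarrow> nat \<Rightarrow> (('f, 'r) fm \<times> 'm list) set" where
  "param_fms M A n =
     {(\<phi>, c). fm_in M \<phi> \<and> set c \<subseteq> A \<and> fvars \<phi> \<subseteq> {..<n + length c}}"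

definition holds ::
  "('f, 'r, 'm) fo_structure \<Rightarrow> 'm list \<Rightarrow> ('f, 'r) fm \<times> 'm list \<Rightarrow> bool" where
  "holds M x p \<longleftrightarrow> sat M (\<lambda>i. (x @ snd p) ! i) (fst p)"

definition definable ::
  "('f, 'r, 'm) fo_structure \<Rightarrow> 'm set \<Rightarrow> nat \<Rightarrow> 'm list set \<Rightarrow> bool" where
  "definable M A n X \<longleftrightarrow>
     (\<exists>p \<in> param_fms M A n. X = {x \<in> tuples (univ M) n. holds M x p})"

definition definable_pfun ::
  "('f, 'r, 'm) fo_structure \<Rightarrow> 'm set \<Rightarrow> nat \<Rightarrow> nat \<Rightarrow> ('m list \<rightharpoonup> 'm list) \<Rightarrow> bool" where
  "definable_pfun M A n k h \<longleftrightarrow>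
     (\<forall>x y. h x = Some y \<longrightarrow> x \<in> tuples (univ M) n \<and> y \<in> tuples (univ M) k) \<and>
     definable M A (n + k) {x @ y |x y. h x = Some y}"

definition definable_map ::
  "('f, 'r, 'm) fo_structure \<Rightarrow> 'm set \<Rightarrow> nat \<Rightarrow> nat \<Rightarrow> 'm list set \<Rightarrow> 'm list set
    \<Rightarrow> ('m list \<Rightarrow> 'm list) \<Rightarrow> bool" where
  "definable_map M A n k X Y f \<longleftrightarrow>
     f \<in> X \<rightarrow> Y \<and> definable_pfun M A n k (\<lambda>x. if x \<in> X then Some (f x) else None)"

definition tp ::
  "('f, 'r, 'm) fo_structure \<Rightarrow> 'm set \<Rightarrow> 'm list \<Rightarrow> (('f, 'r) fm \<times> 'm list) set" where
  "tp M A a = {p \<in> param_fms M A (length a). holds M a p}"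

text \<open>The theory of \<open>M\<close> with constants for \<open>A\<close> is complete, so \<open>p\<close> implies \<open>q\<close> modulo that theory
  iff the implication is true at every tuple of \<open>M\<close>.\<close>

definition isolated_type ::
  "('f, 'r, 'm) fo_structure \<Rightarrow> 'm set \<Rightarrow> nat \<Rightarrow> (('f, 'r) fm \<times> 'm list) set \<Rightarrow> bool" where
  "isolated_type M A n P \<longleftrightarrow>
     (\<exists>p \<in> P. \<forall>q \<in> P. \<forall>x \<in> tuples (univ M) n. holds M x p \<longrightarrow> holds M x q)"

definition atomic_over :: "('f, 'r, 'm) fo_structure \<Rightarrow> 'm set \<Rightarrow> bool" where
  "atomic_over M A \<longleftrightarrow> (\<forall>n. \<forall>a \<in> tuples (univ M) n. isolated_type M A n (tp M A a))"

text \<open>Automorphisms are extended by the identity outside the universe, so that equality and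
  composition of functions are those of automorphisms. They act on tuples by \<open>map \<sigma>\<close>.\<close>

definition Aut :: "('f, 'r, 'm) fo_structure \<Rightarrow> 'm set \<Rightarrow> ('m \<Rightarrow> 'm) set" where
  "Aut M A = {\<sigma>. \<sigma> permutes univ M \<and>
     (\<forall>(f, n) \<in> funs M. \<forall>x \<in> tuples (univ M) n. \<sigma> (fint M f x) = fint M f (map \<sigma> x)) \<and>
     (\<forall>(r, n) \<in> rels M. \<forall>x \<in> tuples (univ M) n. rint M r x \<longleftrightarrow> rint M r (map \<sigma> x)) \<and>
     (\<forall>a \<in> A. \<sigma> a = a)}"

definition homogeneous_over :: "('f, 'r, 'm) fo_structure \<Rightarrow> 'm set \<Rightarrow> bool" where
  "homogeneous_over M A \<longleftrightarrow>
     (\<forall>n. \<forall>a \<in> tuples (univ M) n. \<forall>b \<in> tuples (univ M) n.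
        tp M A a = tp M A b \<longrightarrow> (\<exists>\<sigma> \<in> Aut M A. map \<sigma> a = b))"

text \<open>Elimination of imaginaries in the form that turns quotients into definable sets. For given
  formulas defining \<open>E\<close> and \<open>f\<close> the condition is a first-order sentence, so this is a property of
  the theory of \<open>M\<close>.\<close>

definition eliminates_imaginaries :: "('f, 'r, 'm) fo_structure \<Rightarrow> bool" where
  "eliminates_imaginaries M \<longleftrightarrow>
     (\<forall>n E. equiv (tuples (univ M) n) E \<and> definable M {} (n + n) {x @ y |x y. (x, y) \<in> E} \<longrightarrow>
        (\<exists>k f. definable_map M {} n k (tuples (univ M) n) (tuples (univ M) k) f \<and>
           (\<forall>x \<in> tuples (univ M) n. \<forall>y \<in> tuples (univ M) n. (x, y) \<in> E \<longleftrightarrow> f x = f y)))"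

section \<open>Definable groups and coset spaces\<close>

definition definable_group ::
  "('f, 'r, 'm) fo_structure \<Rightarrow> 'm set \<Rightarrow> nat \<Rightarrow> ('m list) monoid \<Rightarrow> bool" where
  "definable_group M A n G \<longleftrightarrow> group G \<and> definable M A n (carrier G) \<and>
     definable M A (n + n + n)
       {x @ y @ (x \<otimes>\<^bsub>G\<^esub> y) |x y. x \<in> carrier G \<and> y \<in> carrier G}"

text \<open>\<open>Q\<close> is an \<open>A\<close>-definable set identified with the left-coset space \<open>G/N\<close>, the projection being
  \<open>\<pi>\<close>; the distinguished point, the coset \<open>N\<close>, is \<open>\<pi> \<one>\<close>.\<close>

definition is_coset_space ::
  "('f, 'r, 'm) fo_structure \<Rightarrow> 'm set \<Rightarrow> nat \<Rightarrow> ('m list) monoid \<Rightarrow> 'm list set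
    \<Rightarrow> nat \<Rightarrow> 'm list set \<Rightarrow> ('m list \<Rightarrow> 'm list) \<Rightarrow> bool" where
  "is_coset_space M A n G N k Q \<pi> \<longleftrightarrow>
     definable M A k Q \<and> definable_map M A n k (carrier G) Q \<pi> \<and> \<pi> ` carrier G = Q \<and>
     (\<forall>x \<in> carrier G. \<forall>y \<in> carrier G. \<pi> x = \<pi> y \<longleftrightarrow> x <#\<^bsub>G\<^esub> N = y <#\<^bsub>G\<^esub> N)"

text \<open>The group structure of \<open>G/N\<close> on \<open>Q\<close>, for normal \<open>N\<close>: representatives are multiplied, and the
  choice made by \<open>inv_into\<close> is then immaterial.\<close>

definition quotient_group ::
  "('m list) monoid \<Rightarrow> 'm list set \<Rightarrow> ('m list \<Rightarrow> 'm list) \<Rightarrow> ('m list) monoid" where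
  "quotient_group G Q \<pi> =
     \<lparr>carrier = Q,
      monoid.mult = (\<lambda>p q. \<pi> (inv_into (carrier G) \<pi> p \<otimes>\<^bsub>G\<^esub> inv_into (carrier G) \<pi> q)),
      one = \<pi> \<one>\<^bsub>G\<^esub>\<rparr>"

section \<open>Pointed sets\<close>

type_synonym 'a pset = "'a set \<times> 'a"

definition pointed_map :: "'a pset \<Rightarrow> 'b pset \<Rightarrow> ('a \<Rightarrow> 'b) \<Rightarrow> bool" where
  "pointed_map X Y f \<longleftrightarrow> f \<in> fst X \<rightarrow> fst Y \<and> f (snd X) = snd Y"

definition exact_at ::
  "'a pset \<Rightarrow> ('a \<Rightarrow> 'b) \<Rightarrow> 'b pset \<Rightarrow> ('b \<Rightarrow> 'c) \<Rightarrow> 'c pset \<Rightarrow> bool" where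
  "exact_at X f Y g Z \<longleftrightarrow> snd X \<in> fst X \<and> snd Y \<in> fst Y \<and> snd Z \<in> fst Z \<and>
     pointed_map X Y f \<and> pointed_map Y Z g \<and> f ` fst X = {y \<in> fst Y. g y = snd Z}"

section \<open>Definable cohomology\<close>

definition H0 ::
  "('f, 'r, 'm) fo_structure \<Rightarrow> 'm set \<Rightarrow> 'm list set \<Rightarrow> 'm list \<Rightarrow> 'm list pset" where
  "H0 M A X x\<^sub>0 = ({x \<in> X. \<forall>\<sigma> \<in> Aut M A. map \<sigma> x = x}, x\<^sub>0)"

definition H0_map ::
  "('f, 'r, 'm) fo_structure \<Rightarrow> 'm set \<Rightarrow> 'm list set \<Rightarrow> ('m list \<Rightarrow> 'm list)
    \<Rightarrow> 'm list \<Rightarrow> 'm list" where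
  "H0_map M A X f = restrict f {x \<in> X. \<forall>\<sigma> \<in> Aut M A. map \<sigma> x = x}"

definition Z1 ::
  "('f, 'r, 'm) fo_structure \<Rightarrow> 'm set \<Rightarrow> ('m list) monoid \<Rightarrow> (('m \<Rightarrow> 'm) \<Rightarrow> 'm list) set" where
  "Z1 M A G = {\<Phi> \<in> Aut M A \<rightarrow>\<^sub>E carrier G.
     (\<forall>\<sigma> \<in> Aut M A. \<forall>\<tau> \<in> Aut M A. \<Phi> (\<sigma> \<circ> \<tau>) = \<Phi> \<sigma> \<otimes>\<^bsub>G\<^esub> map \<sigma> (\<Phi> \<tau>)) \<and>
     (\<exists>m k h. \<exists>a \<in> tuples (univ M) m. definable_pfun M A (m + m) k h \<and>
        (\<forall>\<sigma> \<in> Aut M A. h (a @ map \<sigma> a) = Some (\<Phi> \<sigma>)))}"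

definition cohomologous ::
  "('f, 'r, 'm) fo_structure \<Rightarrow> 'm set \<Rightarrow> ('m list) monoid
    \<Rightarrow> ((('m \<Rightarrow> 'm) \<Rightarrow> 'm list) \<times> (('m \<Rightarrow> 'm) \<Rightarrow> 'm list)) set" where
  "cohomologous M A G = {(\<Phi>, \<Psi>). \<Phi> \<in> Z1 M A G \<and> \<Psi> \<in> Z1 M A G \<and>
     (\<exists>b \<in> carrier G. \<forall>\<sigma> \<in> Aut M A. \<Psi> \<sigma> = inv\<^bsub>G\<^esub> b \<otimes>\<^bsub>G\<^esub> \<Phi> \<sigma> \<otimes>\<^bsub>G\<^esub> map \<sigma> b)}"

definition H1_class ::
  "('f, 'r, 'm) fo_structure \<Rightarrow> 'm set \<Rightarrow> ('m list) monoid
    \<Rightarrow> (('m \<Rightarrow> 'm) \<Rightarrow> 'm list) \<Rightarrow> (('m \<Rightarrow> 'm) \<Rightarrow> 'm list) set" where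
  "H1_class M A G \<Phi> = cohomologous M A G `` {\<Phi>}"

definition H1 ::
  "('f, 'r, 'm) fo_structure \<Rightarrow> 'm set \<Rightarrow> ('m list) monoid
    \<Rightarrow> (('m \<Rightarrow> 'm) \<Rightarrow> 'm list) set pset" where
  "H1 M A G = (Z1 M A G // cohomologous M A G, H1_class M A G (\<lambda>\<sigma> \<in> Aut M A. \<one>\<^bsub>G\<^esub>))"

text \<open>In the next two definitions \<open>the_elem\<close> picks the common value obtained from all
  representatives.\<close>

definition H1_map ::
  "('f, 'r, 'm) fo_structure \<Rightarrow> 'm set \<Rightarrow> ('m list) monoid \<Rightarrow> ('m list \<Rightarrow> 'm list)
    \<Rightarrow> (('m \<Rightarrow> 'm) \<Rightarrow> 'm list) set \<Rightarrow> (('m \<Rightarrow> 'm) \<Rightarrow> 'm list) set" where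
  "H1_map M A G' f c = the_elem {H1_class M A G' (\<lambda>\<sigma> \<in> Aut M A. f (\<Phi> \<sigma>)) |\<Phi>. \<Phi> \<in> c}"

definition connecting_map ::
  "('f, 'r, 'm) fo_structure \<Rightarrow> 'm set \<Rightarrow> ('m list) monoid \<Rightarrow> 'm list set
    \<Rightarrow> ('m list \<Rightarrow> 'm list) \<Rightarrow> 'm list \<Rightarrow> (('m \<Rightarrow> 'm) \<Rightarrow> 'm list) set" where
  "connecting_map M A G N \<pi> q =
     the_elem {H1_class M A (G\<lparr>carrier := N\<rparr>) (\<lambda>\<sigma> \<in> Aut M A. inv\<^bsub>G\<^esub> b \<otimes>\<^bsub>G\<^esub> map \<sigma> b) |b.
       b \<in> carrier G \<and> \<pi> b = q}"

end

theory Submission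
  imports Defs
begin

text \<open>
  The exactness statements are those of nonabelian cohomology. An element \<open>b\<close> of \<open>G\<close> has an
  invariant coset exactly when \<open>b\<^sup>-\<^sup>1 \<sigma>(b)\<close> lies in \<open>N\<close> for all \<open>\<sigma>\<close>, and then
  \<open>\<sigma> \<mapsto> b\<^sup>-\<^sup>1 \<sigma>(b)\<close> is a cocycle of \<open>N\<close> which is trivial in \<open>G\<close>; conversely a cocycle of \<open>N\<close> that
  becomes trivial in \<open>G\<close> has this form. It is trivial already in \<open>N\<close>, say equal to
  \<open>c\<^sup>-\<^sup>1 \<sigma>(c)\<close>, exactly when \<open>b c\<^sup>-\<^sup>1\<close> is an invariant element of the coset \<open>b N\<close>. For normal \<open>N\<close>, if the
  image of \<open>\<Phi>\<close> in \<open>G/N\<close> is \<open>\<pi>(b)\<^sup>-\<^sup>1 \<sigma>(\<pi>(b))\<close>, then the cohomologous cocycle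
  \<open>b \<Phi>(\<sigma>) \<sigma>(b)\<^sup>-\<^sup>1\<close> takes values in \<open>N\<close>.

  Model theory enters in three places. Automorphisms preserve definable sets
  (\<open>definable_Aut\<close>), so they act on \<open>G\<close> by group automorphisms and commute with \<open>\<pi>\<close>. The cocycles
  constructed above must again be definable; all of them arise from the trivial cocycle or from a given
  one by twisting with an element (\<open>definable_cochain_twist\<close>), by applying a definable map
  (\<open>definable_cochain_map\<close>), or by shrinking the target to a subgroup. These constructions rest on a
  calculus of definable predicates on tuples, closed under Boolean operations, quantifiers over
  tuples and substitution of coordinates and parameters.

  Finally the coset space has to be found inside \<open>M\<close> (\<open>ex_coset_space\<close>). Elimination of imaginaries
  speaks about relations that are definable without parameters, whereas \<open>N\<close> is defined with parameters
  \<open>c\<close> from \<open>A\<close>. One therefore classifies pairs \<open>(x, c)\<close>: if the formula \<open>P(x, z, c)\<close> says that \<open>z\<close> lies in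
  \<open>x N\<close>, then \<open>(x, c)\<close> and \<open>(y, d)\<close> are declared equivalent when \<open>P(x, z, c)\<close> and \<open>P(y, z, d)\<close> agree for all
  \<open>z\<close>. This is an equivalence relation whatever the parameters are, and on the fibre over the given
  \<open>c\<close> it is equality of left cosets.
\<close>

section \<open>Substitution of variables in formulas\<close>

primrec rename_trm :: "(nat \<Rightarrow> nat) \<Rightarrow> 'f trm \<Rightarrow> 'f trm" where
  "rename_trm f (Var i) = Var (f i)"
| "rename_trm f (App g ts) = App g (map (rename_trm f) ts)"

lemma trm_in_rename: "trm_in M t \<Longrightarrow> trm_in M (rename_trm f t)"
  by (induction t) auto

lemma tvars_rename: "tvars (rename_trm f t) = f ` tvars t"
  by (induction t) auto

lemma eval_rename: "eval_trm M e (rename_trm f t) = eval_trm M (e \<circ> f) t"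
proof (induction t)
  case (App g ts)
  then have "map (eval_trm M e) (map (rename_trm f) ts) = map (eval_trm M (e \<circ> f)) ts"
    by (simp add: comp_def)
  then show ?case by (simp only: rename_trm.simps eval_trm.simps)
qed simp

lemma eval_trm_cong: "(\<And>i. i \<in> tvars t \<Longrightarrow> e i = e' i) \<Longrightarrow> eval_trm M e t = eval_trm M e' t"
proof (induction t)
  case (App f ts)
  then have "map (eval_trm M e) ts = map (eval_trm M e') ts"
    by (intro map_cong App.IH) auto
  then show ?case by (simp only: eval_trm.simps)
qed simp

lemma sat_cong: "(\<And>i. i \<in> fvars \<phi> \<Longrightarrow> e i = e' i) \<Longrightarrow> sat M e \<phi> \<longleftrightarrow> sat M e' \<phi>"
proof (induction \<phi> arbitrary: e e')
  case (Eq s t)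
  then have "eval_trm M e s = eval_trm M e' s" "eval_trm M e t = eval_trm M e' t"
    by (auto intro!: eval_trm_cong)
  then show ?case by simp
next
  case (Rel r ts)
  then have "map (eval_trm M e) ts = map (eval_trm M e') ts"
    by (intro map_cong eval_trm_cong) auto
  then show ?case by (simp only: sat.simps)
next
  case (Neg \<phi>)
  have "sat M e \<phi> \<longleftrightarrow> sat M e' \<phi>" using Neg.prems by (intro Neg.IH) auto
  then show ?case by simp
next
  case (And \<phi> \<psi>)
  have "sat M e \<phi> \<longleftrightarrow> sat M e' \<phi>" "sat M e \<psi> \<longleftrightarrow> sat M e' \<psi>"
    using And.prems by (auto intro!: And.IH)
  then show ?case by simp
next
  case (Ex i \<phi>)
  have "sat M (e(i := m)) \<phi> \<longleftrightarrow> sat M (e'(i := m)) \<phi>" for m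
    using Ex.prems by (intro Ex.IH) auto
  then show ?case by simp
qed

lemma finite_tvars: "finite (tvars t)"
  by (induction t) auto

lemma finite_fvars: "finite (fvars \<phi>)"
  by (induction \<phi>) (auto simp: finite_tvars)

text \<open>
  As \<open>f\<close> is arbitrary, this covers the identification of variables. A quantified variable could be
  captured by the image of \<open>f\<close>; it is replaced by a variable outside that image.
\<close>

lemma ex_substituted_formula:
  "\<exists>\<phi>'. (fm_in M \<phi> \<longrightarrow> fm_in M \<phi>') \<and> fvars \<phi>' \<subseteq> f ` fvars \<phi> \<and>
     (\<forall>e. sat M e \<phi>' \<longleftrightarrow> sat M (e \<circ> f) \<phi>)"
proof (induction \<phi> arbitrary: f)
  case (Eq s t)
  show ?case
    by (rule exI[of _ "Eq (rename_trm f s) (rename_trm f t)"])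
      (auto simp: trm_in_rename tvars_rename eval_rename comp_def)
next
  case (Rel r ts)
  show ?case
    by (rule exI[of _ "Rel r (map (rename_trm f) ts)"])
      (auto simp: trm_in_rename tvars_rename eval_rename comp_def)
next
  case (Neg \<phi>)
  then obtain \<phi>' where "(fm_in M \<phi> \<longrightarrow> fm_in M \<phi>') \<and> fvars \<phi>' \<subseteq> f ` fvars \<phi> \<and>
     (\<forall>e. sat M e \<phi>' \<longleftrightarrow> sat M (e \<circ> f) \<phi>)" by blast
  then show ?case by (intro exI[of _ "Neg \<phi>'"]) (auto simp: comp_def)
next
  case (And \<phi> \<psi>)
  obtain \<phi>' \<psi>' where "(fm_in M \<phi> \<longrightarrow> fm_in M \<phi>') \<and> fvars \<phi>' \<subseteq> f ` fvars \<phi> \<and>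
     (\<forall>e. sat M e \<phi>' \<longleftrightarrow> sat M (e \<circ> f) \<phi>)"
    "(fm_in M \<psi> \<longrightarrow> fm_in M \<psi>') \<and> fvars \<psi>' \<subseteq> f ` fvars \<psi> \<and>
     (\<forall>e. sat M e \<psi>' \<longleftrightarrow> sat M (e \<circ> f) \<psi>)" using And.IH[of f] by blast
  then show ?case by (intro exI[of _ "And \<phi>' \<psi>'"]) (auto simp: comp_def)
next
  case (Ex i \<phi>)
  obtain v where v: "v \<notin> f ` fvars \<phi>"
    using ex_new_if_finite[OF infinite_UNIV_nat] finite_fvars by blast
  obtain \<phi>' where \<phi>': "fm_in M \<phi> \<longrightarrow> fm_in M \<phi>'" "fvars \<phi>' \<subseteq> (f(i := v)) ` fvars \<phi>"
     "\<And>e. sat M e \<phi>' \<longleftrightarrow> sat M (e \<circ> f(i := v)) \<phi>" using Ex.IH[of "f(i := v)"] by blast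
  have "sat M (e(v := m)) \<phi>' \<longleftrightarrow> sat M ((e \<circ> f)(i := m)) \<phi>" for e m
    unfolding \<phi>' using v by (intro sat_cong) auto
  moreover have "fvars \<phi>' - {v} \<subseteq> f ` (fvars \<phi> - {i})"
    using \<phi>'(2) by (fastforce split: if_splits)
  ultimately show ?case using \<phi>'(1) by (intro exI[of _ "Ex v \<phi>'"]) (simp add: comp_def)
qed

lemma ex_reindexed_formula:
  assumes "fm_in M \<phi>" "fvars \<phi> \<subseteq> {..<length js}" "set js \<subseteq> {..<l}"
  shows "\<exists>\<phi>'. fm_in M \<phi>' \<and> fvars \<phi>' \<subseteq> {..<l} \<and>
    (\<forall>x. sat M ((!) x) \<phi>' \<longleftrightarrow> sat M ((!) (map ((!) x) js)) \<phi>)"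
proof -
  obtain \<phi>' where \<phi>': "fm_in M \<phi>'" "fvars \<phi>' \<subseteq> (!) js ` fvars \<phi>"
     "\<And>e. sat M e \<phi>' \<longleftrightarrow> sat M (e \<circ> (!) js) \<phi>"
    using ex_substituted_formula[of M \<phi> "(!) js"] assms(1) by blast
  have "sat M ((!) x \<circ> (!) js) \<phi> \<longleftrightarrow> sat M ((!) (map ((!) x) js)) \<phi>" for x
    using assms(2) by (intro sat_cong) auto
  moreover have "fvars \<phi>' \<subseteq> {..<l}"
  proof
    fix v assume "v \<in> fvars \<phi>'"
    then obtain i where "i \<in> fvars \<phi>" "v = js ! i" using \<phi>'(2) by blast
    then show "v \<in> {..<l}" using assms(2,3) nth_mem[of i js] by blast
  qed
  ultimately show ?thesis using \<phi>' by blast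
qed

section \<open>A calculus of definable predicates\<close>

text \<open>
  Working with predicates instead of sets lets proofs of definability follow the syntax of the
  predicate. The formula is compared with it on tuples over the universe.
\<close>

definition definable_pred ::
  "('f, 'r, 'm) fo_structure \<Rightarrow> 'm set \<Rightarrow> nat \<Rightarrow> ('m list \<Rightarrow> bool) \<Rightarrow> bool" where
  "definable_pred M A n P \<longleftrightarrow>
     (\<exists>\<phi> c. fm_in M \<phi> \<and> set c \<subseteq> A \<and> fvars \<phi> \<subseteq> {..<n + length c} \<and>
        (\<forall>x \<in> tuples (univ M) n. P x \<longleftrightarrow> sat M ((!) (x @ c)) \<phi>))"

lemma definable_iff_pred:
  "definable M A n X \<longleftrightarrow> X \<subseteq> tuples (univ M) n \<and> definable_pred M A n (\<lambda>x. x \<in> X)"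
  unfolding definable_def definable_pred_def param_fms_def holds_def by auto blast

text \<open>
  These are the maps that can be substituted into a formula without introducing quantifiers: every
  entry of the result is either a coordinate of the argument or a parameter.
\<close>

definition coord_map ::
  "('f, 'r, 'm) fo_structure \<Rightarrow> 'm set \<Rightarrow> nat \<Rightarrow> nat \<Rightarrow> ('m list \<Rightarrow> 'm list) \<Rightarrow> bool" where
  "coord_map M A n k t \<longleftrightarrow>
     (\<exists>d js. set d \<subseteq> A \<and> length js = k \<and> set js \<subseteq> {..<n + length d} \<and>
        (\<forall>x \<in> tuples (univ M) n. t x = map ((!) (x @ d)) js))"

lemma nth_shift: "map ((!) (x @ c)) [length x..<length x + length c] = c"
  by (intro nth_equalityI) auto

lemma nth_prefix: "map ((!) (x @ c)) [0..<length x] = x"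
  by (intro nth_equalityI) (auto simp: nth_append)

lemma coord_map_id: "coord_map M A n n (\<lambda>x. x)"
  unfolding coord_map_def
  by (rule exI[of _ "[]"], rule exI[of _ "[0..<n]"]) (auto simp: tuples_def map_nth)

lemma coord_map_const: "set c \<subseteq> A \<Longrightarrow> coord_map M A n (length c) (\<lambda>x. c)"
  unfolding coord_map_def
  by (rule exI[of _ c], rule exI[of _ "[n..<n + length c]"])
    (auto simp: tuples_def nth_shift)

lemma coord_map_take: "coord_map M A n k t \<Longrightarrow> i \<le> k \<Longrightarrow> coord_map M A n i (\<lambda>x. take i (t x))"
  unfolding coord_map_def
  by (elim exE conjE, rule_tac x = d in exI, rule_tac x = "take i js" in exI)
    (auto simp: take_map dest!: in_set_takeD)

lemma coord_map_drop: "coord_map M A n k t \<Longrightarrow> k' = k - i \<Longrightarrow> coord_map M A n k' (\<lambda>x. drop i (t x))"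
  unfolding coord_map_def
  by (elim exE conjE, rule_tac x = d in exI, rule_tac x = "drop i js" in exI)
    (auto simp: drop_map dest!: in_set_dropD)

lemma coord_map_append:
  assumes "coord_map M A n k s" "coord_map M A n l t" "j = k + l"
  shows "coord_map M A n j (\<lambda>x. s x @ t x)"
proof -
  obtain c ks where 1: "set c \<subseteq> A" "length ks = k" "set ks \<subseteq> {..<n + length c}"
    "\<And>x. x \<in> tuples (univ M) n \<Longrightarrow> s x = map ((!) (x @ c)) ks"
    using assms(1) unfolding coord_map_def by blast
  obtain d js where 2: "set d \<subseteq> A" "length js = l" "set js \<subseteq> {..<n + length d}"
    "\<And>x. x \<in> tuples (univ M) n \<Longrightarrow> t x = map ((!) (x @ d)) js"
    using assms(2) unfolding coord_map_def by blast
  let ?js = "map (\<lambda>j. if j < n then j else j + length c) js"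
  have "s x @ t x = map ((!) (x @ c @ d)) (ks @ ?js)" if "x \<in> tuples (univ M) n" for x
    using 1 2 that by (auto simp: tuples_def nth_append)
  moreover have "set (ks @ ?js) \<subseteq> {..<n + length (c @ d)}" using 1 2 by fastforce
  ultimately show ?thesis unfolding coord_map_def using 1 2 assms(3)
    by (intro exI[of _ "c @ d"] exI[of _ "ks @ ?js"]) simp
qed

lemmas coord_map_intros = coord_map_append coord_map_take coord_map_drop coord_map_id coord_map_const

lemma coord_map_in:
  assumes "coord_map M A n k t" "A \<subseteq> univ M" "x \<in> tuples (univ M) n"
  shows "t x \<in> tuples (univ M) k"
proof -
  obtain d js where 2: "set d \<subseteq> A" "length js = k" "set js \<subseteq> {..<n + length d}"
    "\<And>x. x \<in> tuples (univ M) n \<Longrightarrow> t x = map ((!) (x @ d)) js"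
    using assms(1) unfolding coord_map_def by blast
  have "(x @ d) ! j \<in> univ M" if "j \<in> set js" for j
  proof -
    have "j < length (x @ d)" using that 2 assms(3) by (auto simp: tuples_def)
    then have "(x @ d) ! j \<in> set (x @ d)" by (rule nth_mem)
    then show ?thesis using 2 assms by (auto simp: tuples_def)
  qed
  then show ?thesis using 2 assms(3) by (auto simp: tuples_def)
qed

lemma definable_pred_comp:
  assumes "definable_pred M A k P" "coord_map M A n k t" "A \<subseteq> univ M"
  shows "definable_pred M A n (\<lambda>x. P (t x))"
proof -
  obtain \<phi> c where 1: "fm_in M \<phi>" "set c \<subseteq> A" "fvars \<phi> \<subseteq> {..<k + length c}"
    "\<And>x. x \<in> tuples (univ M) k \<Longrightarrow> P x \<longleftrightarrow> sat M ((!) (x @ c)) \<phi>"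
    using assms(1) unfolding definable_pred_def by blast
  obtain d js where 2: "set d \<subseteq> A" "length js = k" "set js \<subseteq> {..<n + length d}"
    "\<And>x. x \<in> tuples (univ M) n \<Longrightarrow> t x = map ((!) (x @ d)) js"
    using assms(2) unfolding coord_map_def by blast
  let ?js = "js @ [n + length d..<n + length d + length c]"
  obtain \<phi>' where 3: "fm_in M \<phi>'" "fvars \<phi>' \<subseteq> {..<n + length (d @ c)}"
    "\<And>x. sat M ((!) x) \<phi>' \<longleftrightarrow> sat M ((!) (map ((!) x) ?js)) \<phi>"
    using ex_reindexed_formula[of M \<phi> ?js "n + length (d @ c)"] 1 2 by fastforce
  have "map ((!) (x @ d @ c)) ?js = t x @ c" if x: "x \<in> tuples (univ M) n" for x
  proof -
    have "map ((!) (x @ d @ c)) js = t x"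
      using 2 x by (auto simp: tuples_def nth_append)
    moreover have "map ((!) (x @ d @ c)) [n + length d..<n + length d + length c] = c"
      using nth_shift[of "x @ d" c] x by (simp add: tuples_def)
    ultimately show ?thesis by simp
  qed
  then have "P (t x) \<longleftrightarrow> sat M ((!) (x @ d @ c)) \<phi>'" if "x \<in> tuples (univ M) n" for x
    using 1(4) 3(3) coord_map_in[OF assms(2,3) that] that by simp
  then show ?thesis unfolding definable_pred_def using 1 2 3
    by (intro exI[of _ \<phi>'] exI[of _ "d @ c"]) auto
qed

lemma definable_pred_not: "definable_pred M A n P \<Longrightarrow> definable_pred M A n (\<lambda>x. \<not> P x)"
  unfolding definable_pred_def by (metis fm_in.simps(3) fvars.simps(3) sat.simps(3))

lemma definable_pred_cong:
  "definable_pred M A n P \<Longrightarrow> (\<And>x. x \<in> tuples (univ M) n \<Longrightarrow> P x \<longleftrightarrow> Q x) \<Longrightarrow> definable_pred M A n Q"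
  unfolding definable_pred_def by metis

text \<open>
  The two formulas may use different parameters. Both get the concatenated list, for which the
  parameter variables of the second formula have to be shifted.
\<close>

lemma definable_pred_and:
  assumes "definable_pred M A n P" "definable_pred M A n Q"
  shows "definable_pred M A n (\<lambda>x. P x \<and> Q x)"
proof -
  obtain \<phi> c where 1: "fm_in M \<phi>" "set c \<subseteq> A" "fvars \<phi> \<subseteq> {..<n + length c}"
    "\<And>x. x \<in> tuples (univ M) n \<Longrightarrow> P x \<longleftrightarrow> sat M ((!) (x @ c)) \<phi>"
    using assms(1) unfolding definable_pred_def by blast
  obtain \<psi> d where 2: "fm_in M \<psi>" "set d \<subseteq> A" "fvars \<psi> \<subseteq> {..<n + length d}"
    "\<And>x. x \<in> tuples (univ M) n \<Longrightarrow> Q x \<longleftrightarrow> sat M ((!) (x @ d)) \<psi>"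
    using assms(2) unfolding definable_pred_def by blast
  let ?js = "[0..<n] @ [n + length c..<n + length c + length d]"
  obtain \<psi>' where 3: "fm_in M \<psi>'" "fvars \<psi>' \<subseteq> {..<n + length (c @ d)}"
    "\<And>x. sat M ((!) x) \<psi>' \<longleftrightarrow> sat M ((!) (map ((!) x) ?js)) \<psi>"
    using ex_reindexed_formula[of M \<psi> ?js "n + length (c @ d)"] 2 by fastforce
  have "sat M ((!) (x @ c @ d)) \<phi> \<longleftrightarrow> P x" if "x \<in> tuples (univ M) n" for x
    unfolding 1(4)[OF that] using 1(3) that
    by (intro sat_cong) (auto simp: tuples_def nth_append)
  moreover have "sat M ((!) (x @ c @ d)) \<psi>' \<longleftrightarrow> Q x" if x: "x \<in> tuples (univ M) n" for x
  proof -
    have "map ((!) (x @ c @ d)) ?js = x @ d"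
      using nth_prefix[of x "c @ d"] nth_shift[of "x @ c" d] x by (simp add: tuples_def)
    then show ?thesis using 2(4)[OF x] 3(3) by simp
  qed
  ultimately show ?thesis unfolding definable_pred_def using 1 2 3
    by (intro exI[of _ "And \<phi> \<psi>'"] exI[of _ "c @ d"]) auto
qed

lemma definable_pred_iff:
  assumes "definable_pred M A n P" "definable_pred M A n Q"
  shows "definable_pred M A n (\<lambda>x. P x \<longleftrightarrow> Q x)"
proof -
  have "definable_pred M A n (\<lambda>x. \<not> (P x \<and> \<not> Q x) \<and> \<not> (Q x \<and> \<not> P x))"
    by (intro definable_pred_and definable_pred_not assms)
  then show ?thesis by (rule definable_pred_cong) auto
qed

text \<open>
  In a formula for \<open>P\<close> the quantified variable stands between the object variables and the
  parameters. Moving it behind the parameters leaves the variables in the order required of a formula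
  in \<open>n\<close> object variables.
\<close>

lemma definable_pred_ex1:
  assumes "definable_pred M A (Suc n) P"
  shows "definable_pred M A n (\<lambda>x. \<exists>m \<in> univ M. P (x @ [m]))"
proof -
  obtain \<phi> c where 1: "fm_in M \<phi>" "set c \<subseteq> A" "fvars \<phi> \<subseteq> {..<Suc n + length c}"
    "\<And>x. x \<in> tuples (univ M) (Suc n) \<Longrightarrow> P x \<longleftrightarrow> sat M ((!) (x @ c)) \<phi>"
    using assms(1) unfolding definable_pred_def by blast
  let ?v = "n + length c"
  let ?js = "[0..<n] @ [?v] @ [n..<n + length c]"
  obtain \<phi>' where 3: "fm_in M \<phi>'" "fvars \<phi>' \<subseteq> {..<Suc ?v}"
    "\<And>x. sat M ((!) x) \<phi>' \<longleftrightarrow> sat M ((!) (map ((!) x) ?js)) \<phi>"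
    using ex_reindexed_formula[of M \<phi> ?js "Suc ?v"] 1 by fastforce
  have "sat M (((!) (x @ c))(?v := m)) \<phi>' \<longleftrightarrow> P (x @ [m])"
    if x: "x \<in> tuples (univ M) n" and m: "m \<in> univ M" for x m
  proof -
    have "sat M (((!) (x @ c))(?v := m)) \<phi>' \<longleftrightarrow> sat M ((!) (x @ c @ [m])) \<phi>'"
    proof (rule sat_cong)
      fix i assume "i \<in> fvars \<phi>'"
      then have "i < Suc ?v" using 3(2) by auto
      then show "(((!) (x @ c))(?v := m)) i = (x @ c @ [m]) ! i"
        using x nth_append[of "x @ c" "[m]" i] by (auto simp: tuples_def)
    qed
    also have "map ((!) (x @ c @ [m])) ?js = x @ [m] @ c"
    proof -
      have "map ((!) (x @ c @ [m])) [n..<n + length c] = c"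
        using x by (intro nth_equalityI) (auto simp: tuples_def nth_append)
      moreover have "(x @ c @ [m]) ! ?v = m"
        using x nth_append_length[of "x @ c" m "[]"] by (simp add: tuples_def)
      ultimately show ?thesis using nth_prefix[of x "c @ [m]"] x by (simp add: tuples_def)
    qed
    then have "sat M ((!) (x @ c @ [m])) \<phi>' \<longleftrightarrow> P (x @ [m])"
      using 1(4)[of "x @ [m]"] x m unfolding 3(3) by (simp add: tuples_def)
    finally show ?thesis .
  qed
  then show ?thesis unfolding definable_pred_def using 1 3
    by (intro exI[of _ "Ex ?v \<phi>'"] exI[of _ c]) fastforce
qed

lemma definable_pred_ex_append:
  "definable_pred M A (n + k) P \<Longrightarrow> definable_pred M A n (\<lambda>x. \<exists>y \<in> tuples (univ M) k. P (x @ y))"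
proof (induction k arbitrary: P)
  case 0
  then show ?case by (simp add: tuples_def)
next
  case (Suc k)
  have "definable_pred M A n (\<lambda>x. \<exists>y \<in> tuples (univ M) k. \<exists>m \<in> univ M. P ((x @ y) @ [m]))"
    using Suc.prems by (intro Suc.IH definable_pred_ex1) simp
  moreover have "(\<exists>y \<in> tuples (univ M) k. \<exists>m \<in> univ M. P ((x @ y) @ [m])) \<longleftrightarrow>
      (\<exists>y \<in> tuples (univ M) (Suc k). P (x @ y))" for x
  proof
    assume "\<exists>y \<in> tuples (univ M) k. \<exists>m \<in> univ M. P ((x @ y) @ [m])"
    then obtain y m where "y \<in> tuples (univ M) k" "m \<in> univ M" "P ((x @ y) @ [m])" by blast
    then show "\<exists>y \<in> tuples (univ M) (Suc k). P (x @ y)"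
      by (intro bexI[of _ "y @ [m]"]) (auto simp: tuples_def)
  next
    assume "\<exists>y \<in> tuples (univ M) (Suc k). P (x @ y)"
    then obtain y where y: "y \<in> tuples (univ M) (Suc k)" "P (x @ y)" by blast
    then obtain z m where "y = z @ [m]" by (cases y rule: rev_cases) (auto simp: tuples_def)
    then show "\<exists>y \<in> tuples (univ M) k. \<exists>m \<in> univ M. P ((x @ y) @ [m])"
      using y by (auto simp: tuples_def)
  qed
  ultimately show ?case by simp
qed

text \<open>
  The bound tuple is appended to the context \<open>x\<close> and both are recovered by \<open>take\<close> and \<open>drop\<close>, which are
  coordinate maps. Hence the rules of the calculus can be applied under nested quantifiers.
\<close>

lemma definable_pred_ex:
  assumes "definable_pred M A (n + k) (\<lambda>w. P (take n w) (drop n w))"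
  shows "definable_pred M A n (\<lambda>x. \<exists>y \<in> tuples (univ M) k. P x y)"
  by (rule definable_pred_cong[OF definable_pred_ex_append[OF assms]])
    (auto simp: tuples_def)

lemma definable_pred_all:
  assumes "definable_pred M A (n + k) (\<lambda>w. P (take n w) (drop n w))"
  shows "definable_pred M A n (\<lambda>x. \<forall>y \<in> tuples (univ M) k. P x y)"
proof -
  have "definable_pred M A n (\<lambda>x. \<not> (\<exists>y \<in> tuples (univ M) k. \<not> P x y))"
    by (intro definable_pred_not definable_pred_ex assms)
  then show ?thesis by simp
qed

lemma definable_pred_mem:
  assumes "definable M A k X" "A \<subseteq> univ M" "coord_map M A n k t"
  shows "definable_pred M A n (\<lambda>x. t x \<in> X)"
  using definable_pred_comp[of M A k "\<lambda>x. x \<in> X"] assms by (simp add: definable_iff_pred)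

lemma tuples_append: "x @ y \<in> tuples S (n + k) \<longleftrightarrow> x \<in> tuples S n \<and> y \<in> tuples S k"
  if "length x = n \<or> length y = k"
  using that by (auto simp: tuples_def)

lemma tuples_appendD: "v \<in> tuples S (n + k) \<Longrightarrow> take n v \<in> tuples S n \<and> drop n v \<in> tuples S k"
  by (auto simp: tuples_def dest: in_set_takeD in_set_dropD)

lemma tuples_length: "x \<in> tuples S n \<Longrightarrow> length x = n"
  by (simp add: tuples_def)

lemma definable_concatI:
  assumes "definable_pred M A (n + k) (\<lambda>v. R (take n v) (drop n v))"
    and "\<And>x y. R x y \<Longrightarrow> x \<in> tuples (univ M) n \<and> y \<in> tuples (univ M) k"
  shows "definable M A (n + k) {x @ y |x y. R x y}"
  unfolding definable_iff_pred
proof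
  show "{x @ y |x y. R x y} \<subseteq> tuples (univ M) (n + k)"
    using assms(2) by (fastforce simp: tuples_def)
  have "R (take n v) (drop n v) \<longleftrightarrow> v \<in> {x @ y |x y. R x y}" if "v \<in> tuples (univ M) (n + k)" for v
  proof
    assume "R (take n v) (drop n v)"
    then have "take n v @ drop n v \<in> {x @ y |x y. R x y}" by blast
    then show "v \<in> {x @ y |x y. R x y}" by simp
  next
    assume "v \<in> {x @ y |x y. R x y}"
    then obtain x y where "v = x @ y" "R x y" by blast
    then show "R (take n v) (drop n v)" using assms(2)[of x y] by (simp add: tuples_def)
  qed
  then show "definable_pred M A (n + k) (\<lambda>v. v \<in> {x @ y |x y. R x y})"
    by (rule definable_pred_cong[OF assms(1)])
qed

lemma definable_concat3I:
  assumes "definable_pred M A (n + k + l) (\<lambda>v. R (take n v) (take k (drop n v)) (drop (n + k) v))"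
    and "\<And>x y z. R x y z \<Longrightarrow> x \<in> tuples (univ M) n \<and> y \<in> tuples (univ M) k \<and> z \<in> tuples (univ M) l"
  shows "definable M A (n + k + l) {x @ y @ z |x y z. R x y z}"
proof -
  let ?R = "\<lambda>v z. R (take n v) (drop n v) z \<and> length v = n + k"
  have "definable M A (n + k + l) {v @ z |v z. ?R v z}"
  proof (rule definable_concatI)
    show "definable_pred M A (n + k + l) (\<lambda>v. ?R (take (n + k) v) (drop (n + k) v))"
      by (rule definable_pred_cong[OF assms(1)]) (auto simp: tuples_def drop_take)
    fix v z assume "?R v z"
    then show "v \<in> tuples (univ M) (n + k) \<and> z \<in> tuples (univ M) l"
      using assms(2)[of "take n v" "drop n v" z] tuples_append[of "take n v" n "drop n v" k]
      by (simp add: tuples_length)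
  qed
  moreover have "{v @ z |v z. ?R v z} = {x @ y @ z |x y z. R x y z}" (is "?L = ?R'")
  proof
    show "?L \<subseteq> ?R'"
    proof
      fix w assume "w \<in> ?L"
      then obtain v z where "w = (take n v @ drop n v) @ z" "R (take n v) (drop n v) z" by auto
      then show "w \<in> ?R'" unfolding append_assoc by blast
    qed
    show "?R' \<subseteq> ?L"
    proof
      fix w assume "w \<in> ?R'"
      then obtain x y z where w: "w = (x @ y) @ z" "R x y z" by auto
      then have "?R (x @ y) z" using assms(2)[OF w(2)] by (simp add: tuples_def)
      then show "w \<in> ?L" using w(1) by blast
    qed
  qed
  ultimately show ?thesis by simp
qed

text \<open>
  A definable relation that is functional is the graph of a definable partial function, so a
  function can be presented by an equation for its value.
\<close>

lemma ex_definable_pfun: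
  assumes "definable_pred M A (n + k) (\<lambda>v. R (take n v) (drop n v))"
    and "\<And>x y z. R x y \<Longrightarrow> R x z \<Longrightarrow> y = z"
  shows "\<exists>h. definable_pfun M A n k h \<and>
    (\<forall>x \<in> tuples (univ M) n. \<forall>y \<in> tuples (univ M) k. R x y \<longrightarrow> h x = Some y)"
proof -
  let ?R = "\<lambda>x y. x \<in> tuples (univ M) n \<and> y \<in> tuples (univ M) k \<and> R x y"
  define h where "h x = (if \<exists>y. ?R x y then Some (THE y. ?R x y) else None)" for x
  have h: "h x = Some y \<longleftrightarrow> ?R x y" for x y
  proof -
    have "(THE y. ?R x y) = y" if "?R x y" for y
      using that assms(2)[of x] by (intro the_equality) auto
    then show ?thesis unfolding h_def by auto
  qed
  have "definable M A (n + k) {x @ y |x y. ?R x y}"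
    by (rule definable_concatI[OF definable_pred_cong[OF assms(1)]])
      (auto dest: tuples_appendD)
  then have "definable_pfun M A n k h" unfolding definable_pfun_def h by auto
  then show ?thesis using h by blast
qed

text \<open>
  Turning the parameters into further object variables: \<open>P\<close> is the fibre over \<open>c\<close> of a family that is
  definable without parameters.
\<close>

lemma definable_pred_split_params:
  assumes "definable_pred M A n P"
  obtains c P' where "set c \<subseteq> A" "definable_pred M {} (n + length c) P'"
    "\<And>x. x \<in> tuples (univ M) n \<Longrightarrow> P' (x @ c) \<longleftrightarrow> P x"
proof -
  obtain \<phi> c where 1: "fm_in M \<phi>" "set c \<subseteq> A" "fvars \<phi> \<subseteq> {..<n + length c}"
    "\<And>x. x \<in> tuples (univ M) n \<Longrightarrow> P x \<longleftrightarrow> sat M ((!) (x @ c)) \<phi>"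
    using assms(1) unfolding definable_pred_def by blast
  have "definable_pred M {} (n + length c) (\<lambda>w. sat M ((!) w) \<phi>)"
    unfolding definable_pred_def using 1 by (intro exI[of _ \<phi>] exI[of _ "[]"]) auto
  then show thesis using that 1 by blast
qed

lemma definable_mono: "definable M B n X \<Longrightarrow> B \<subseteq> A \<Longrightarrow> definable M A n X"
  unfolding definable_iff_pred definable_pred_def by blast

section \<open>Automorphisms preserve definable sets and maps\<close>

lemma eval_trm_in:
  assumes "is_structure M" "\<And>i. e i \<in> univ M"
  shows "trm_in M t \<Longrightarrow> eval_trm M e t \<in> univ M"
proof (induction t)
  case (App f ts)
  then have "map (eval_trm M e) ts \<in> tuples (univ M) (length ts)" by (auto simp: tuples_def)
  then show ?case using App.prems assms(1) by (fastforce simp: is_structure_def)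
qed (use assms in auto)

lemma Aut_permutes: "\<sigma> \<in> Aut M A \<Longrightarrow> \<sigma> permutes univ M"
  by (simp add: Aut_def)

lemma Aut_in: "\<sigma> \<in> Aut M A \<Longrightarrow> x \<in> univ M \<Longrightarrow> \<sigma> x \<in> univ M"
  by (simp add: permutes_in_image[OF Aut_permutes])

lemma Aut_tuples: "\<sigma> \<in> Aut M A \<Longrightarrow> x \<in> tuples (univ M) n \<Longrightarrow> map \<sigma> x \<in> tuples (univ M) n"
  using Aut_in[of \<sigma> M A] by (auto simp: tuples_def)

lemma Aut_fint:
  "\<sigma> \<in> Aut M A \<Longrightarrow> (f, n) \<in> funs M \<Longrightarrow> x \<in> tuples (univ M) n \<Longrightarrow> \<sigma> (fint M f x) = fint M f (map \<sigma> x)"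
  by (auto simp: Aut_def)

lemma Aut_rint:
  "\<sigma> \<in> Aut M A \<Longrightarrow> (r, n) \<in> rels M \<Longrightarrow> x \<in> tuples (univ M) n \<Longrightarrow> rint M r (map \<sigma> x) \<longleftrightarrow> rint M r x"
  by (auto simp: Aut_def)

lemma Aut_param: "\<sigma> \<in> Aut M A \<Longrightarrow> a \<in> A \<Longrightarrow> \<sigma> a = a"
  by (auto simp: Aut_def)

lemma Aut_id: "id \<in> Aut M A"
  by (auto simp: Aut_def)

lemma Aut_comp:
  assumes "\<sigma> \<in> Aut M A" "\<tau> \<in> Aut M A"
  shows "\<sigma> \<circ> \<tau> \<in> Aut M A"
proof -
  have "(\<sigma> \<circ> \<tau>) (fint M f x) = fint M f (map (\<sigma> \<circ> \<tau>) x)"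
    if "(f, n) \<in> funs M" "x \<in> tuples (univ M) n" for f n x
    using Aut_fint[OF assms(2) that] Aut_fint[OF assms(1) that(1) Aut_tuples[OF assms(2) that(2)]]
    by simp
  moreover have "rint M r x \<longleftrightarrow> rint M r (map (\<sigma> \<circ> \<tau>) x)"
    if "(r, n) \<in> rels M" "x \<in> tuples (univ M) n" for r n x
    using Aut_rint[OF assms(2) that] Aut_rint[OF assms(1) that(1) Aut_tuples[OF assms(2) that(2)]]
    by simp
  moreover have "\<sigma> \<circ> \<tau> permutes univ M"
    by (rule permutes_compose[OF assms(2)[THEN Aut_permutes] assms(1)[THEN Aut_permutes]])
  moreover have "(\<sigma> \<circ> \<tau>) a = a" if "a \<in> A" for a
    using Aut_param[OF assms(1) that] Aut_param[OF assms(2) that] by simp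
  ultimately show ?thesis unfolding Aut_def by blast
qed

lemma eval_trm_Aut:
  assumes "is_structure M" "\<And>i. e i \<in> univ M" "\<sigma> \<in> Aut M A"
  shows "trm_in M t \<Longrightarrow> eval_trm M (\<sigma> \<circ> e) t = \<sigma> (eval_trm M e t)"
proof (induction t)
  case (App f ts)
  then have "map (eval_trm M e) ts \<in> tuples (univ M) (length ts)"
    using eval_trm_in[OF assms(1,2)] by (auto simp: tuples_def)
  then have "\<sigma> (eval_trm M e (App f ts)) = fint M f (map \<sigma> (map (eval_trm M e) ts))"
    using App.prems Aut_fint[OF assms(3), of f "length ts" "map (eval_trm M e) ts"] by simp
  also have "map \<sigma> (map (eval_trm M e) ts) = map (eval_trm M (\<sigma> \<circ> e)) ts"
    using App by (simp add: comp_def)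
  finally show ?case by (simp add: comp_def)
qed simp

text \<open>
  Isomorphism invariance of truth. The quantifier step uses that \<open>\<sigma>\<close> maps the universe onto itself.
\<close>

lemma sat_Aut:
  assumes "is_structure M" "\<sigma> \<in> Aut M A"
  shows "fm_in M \<phi> \<Longrightarrow> (\<And>i. e i \<in> univ M) \<Longrightarrow> sat M (\<sigma> \<circ> e) \<phi> \<longleftrightarrow> sat M e \<phi>"
proof (induction \<phi> arbitrary: e)
  case (Eq s t)
  then have "eval_trm M (\<sigma> \<circ> e) s = \<sigma> (eval_trm M e s)" "eval_trm M (\<sigma> \<circ> e) t = \<sigma> (eval_trm M e t)"
    using eval_trm_Aut[OF assms(1) _ assms(2)] by auto
  then show ?case
    using inj_eq[OF permutes_inj[OF Aut_permutes[OF assms(2)]]] by (simp add: comp_def)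
next
  case (Rel r ts)
  then have "map (eval_trm M e) ts \<in> tuples (univ M) (length ts)"
    using eval_trm_in[OF assms(1)] by (auto simp: tuples_def)
  moreover have "map (eval_trm M (\<sigma> \<circ> e)) ts = map \<sigma> (map (eval_trm M e) ts)"
    using Rel eval_trm_Aut[OF assms(1) _ assms(2)] by auto
  ultimately have "rint M r (map (eval_trm M (\<sigma> \<circ> e)) ts) \<longleftrightarrow> rint M r (map (eval_trm M e) ts)"
    using Rel.prems(1) Aut_rint[OF assms(2), of r "length ts"] by (simp del: map_map)
  then show ?case by (simp only: sat.simps)
next
  case (Ex i \<phi>)
  have "sat M ((\<sigma> \<circ> e)(i := \<sigma> m)) \<phi> \<longleftrightarrow> sat M (e(i := m)) \<phi>" if "m \<in> univ M" for m
  proof -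
    have "(\<sigma> \<circ> e)(i := \<sigma> m) = \<sigma> \<circ> e(i := m)" by auto
    moreover have "sat M (\<sigma> \<circ> e(i := m)) \<phi> \<longleftrightarrow> sat M (e(i := m)) \<phi>"
      using Ex.prems that by (intro Ex.IH) auto
    ultimately show ?thesis by simp
  qed
  moreover have "(\<exists>m \<in> univ M. sat M ((\<sigma> \<circ> e)(i := m)) \<phi>) \<longleftrightarrow>
      (\<exists>m \<in> univ M. sat M ((\<sigma> \<circ> e)(i := \<sigma> m)) \<phi>)"
    using permutes_image[OF Aut_permutes[OF assms(2)]] by (metis (no_types, lifting) image_iff)
  ultimately show ?case by (simp add: comp_def)
qed (auto simp: comp_def)

lemma definable_Aut:
  assumes "is_structure M" "A \<subseteq> univ M" "definable M A n X" "\<sigma> \<in> Aut M A" "x \<in> X"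
  shows "map \<sigma> x \<in> X"
proof -
  obtain \<phi> c where 1: "fm_in M \<phi>" "set c \<subseteq> A" "fvars \<phi> \<subseteq> {..<n + length c}"
    "\<And>x. x \<in> tuples (univ M) n \<Longrightarrow> x \<in> X \<longleftrightarrow> sat M ((!) (x @ c)) \<phi>" and X: "X \<subseteq> tuples (univ M) n"
    using assms(3) unfolding definable_iff_pred definable_pred_def by blast
  have x: "x \<in> tuples (univ M) n" using X assms(5) by blast
  obtain u where u: "u \<in> univ M" using assms(1) by (auto simp: is_structure_def)
  \<comment> \<open>Beyond its length the list \<open>x @ c\<close> has unspecified entries, possibly outside the universe.
    Padding with \<open>u\<close> gives an assignment with values in the universe.\<close>
  define e where "e i = (if i < n + length c then (x @ c) ! i else u)" for i
  have e: "e i \<in> univ M" for i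
  proof (cases "i < n + length c")
    case True
    then have "(x @ c) ! i \<in> set (x @ c)" using x by (intro nth_mem) (simp add: tuples_def)
    then show ?thesis using True 1(2) assms(2) x by (auto simp: e_def tuples_def)
  qed (use u in \<open>simp add: e_def\<close>)
  have "map \<sigma> x \<in> X \<longleftrightarrow> sat M ((!) (map \<sigma> x @ c)) \<phi>" using 1(4) Aut_tuples assms(4) x by blast
  also have "\<dots> \<longleftrightarrow> sat M (\<sigma> \<circ> e) \<phi>"
  proof (rule sat_cong)
    fix i assume "i \<in> fvars \<phi>"
    then have i: "i < n + length c" using 1(3) by auto
    have "map \<sigma> c = c" using 1(2) Aut_param[OF assms(4)] by (simp add: map_idI subset_iff)
    then have "(map \<sigma> x @ c) ! i = map \<sigma> (x @ c) ! i" by simp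
    also have "\<dots> = \<sigma> ((x @ c) ! i)" using i x by (intro nth_map) (simp add: tuples_def)
    finally show "(map \<sigma> x @ c) ! i = (\<sigma> \<circ> e) i" using i by (simp add: e_def)
  qed
  also have "\<dots> \<longleftrightarrow> sat M e \<phi>" by (rule sat_Aut[OF assms(1,4) 1(1) e])
  also have "\<dots> \<longleftrightarrow> sat M ((!) (x @ c)) \<phi>" using 1(3) by (intro sat_cong) (auto simp: e_def)
  also have "\<dots> \<longleftrightarrow> x \<in> X" using 1(4) x by blast
  finally show ?thesis using assms(5) by blast
qed

lemma definable_map_iff:
  "definable_map M A n k X Y f \<longleftrightarrow> f \<in> X \<rightarrow> Y \<and> X \<subseteq> tuples (univ M) n \<and> f ` X \<subseteq> tuples (univ M) k \<and>
     definable M A (n + k) {x @ f x |x. x \<in> X}"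
proof -
  have "{x @ y |x y. (if x \<in> X then Some (f x) else None) = Some y} = {x @ f x |x. x \<in> X}"
    by (auto split: if_splits)
  moreover have "(\<forall>x y. (if x \<in> X then Some (f x) else None) = Some y \<longrightarrow>
      x \<in> tuples (univ M) n \<and> y \<in> tuples (univ M) k) \<longleftrightarrow>
      X \<subseteq> tuples (univ M) n \<and> f ` X \<subseteq> tuples (univ M) k"
    by (auto split: if_splits)
  ultimately show ?thesis unfolding definable_map_def definable_pfun_def by argo
qed

lemma graph_mem:
  assumes "length x = n" "X \<subseteq> tuples S n"
  shows "x @ y \<in> {x @ f x |x. x \<in> X} \<longleftrightarrow> x \<in> X \<and> y = f x"
proof
  assume "x @ y \<in> {x @ f x |x. x \<in> X}"
  then obtain x' where x': "x @ y = x' @ f x'" "x' \<in> X" by blast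
  then have "length x' = length x" using assms tuples_length by blast
  then show "x \<in> X \<and> y = f x" using x' by simp
qed blast

text \<open>
  The automorphism preserves the graph of \<open>f\<close>.
\<close>

lemma definable_map_Aut:
  assumes "is_structure M" "A \<subseteq> univ M" "definable_map M A n k X Y f" "\<sigma> \<in> Aut M A" "x \<in> X"
  shows "f (map \<sigma> x) = map \<sigma> (f x)"
proof -
  have *: "X \<subseteq> tuples (univ M) n" "definable M A (n + k) {x @ f x |x. x \<in> X}"
    using assms(3) by (simp_all add: definable_map_iff)
  have "map \<sigma> (x @ f x) \<in> {x @ f x |x. x \<in> X}"
    by (rule definable_Aut[OF assms(1,2) *(2) assms(4)]) (use assms(5) in blast)
  moreover have "length (map \<sigma> x) = n" using *(1) assms(5) tuples_length by auto
  ultimately show ?thesis using graph_mem[OF _ *(1), of "map \<sigma> x" "map \<sigma> (f x)" f] by simp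
qed

section \<open>Definable cochains and cocycles\<close>

lemma length_coord_map:
  "coord_map M A n k t \<Longrightarrow> A \<subseteq> univ M \<Longrightarrow> x \<in> tuples (univ M) n \<Longrightarrow> length (t x) = k"
  by (rule tuples_length[OF coord_map_in])

lemma definable_pred_map:
  assumes "definable_map M A n k X Y f" "A \<subseteq> univ M" "coord_map M A l n s" "coord_map M A l k t"
  shows "definable_pred M A l (\<lambda>w. s w \<in> X \<and> t w = f (s w))"
proof -
  have f: "X \<subseteq> tuples (univ M) n" "definable M A (n + k) {x @ f x |x. x \<in> X}"
    using assms(1) by (simp_all add: definable_map_iff)
  have "definable_pred M A l (\<lambda>w. s w @ t w \<in> {x @ f x |x. x \<in> X})"
    by (rule definable_pred_mem[OF f(2) assms(2) coord_map_append[OF assms(3,4)]]) simp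
  then show ?thesis
    by (rule definable_pred_cong) (rule graph_mem[OF length_coord_map[OF assms(3,2)] f(1)])
qed

lemma definable_pred_pfun:
  assumes "definable_pfun M A n k h" "A \<subseteq> univ M" "coord_map M A l n s" "coord_map M A l k t"
  shows "definable_pred M A l (\<lambda>w. h (s w) = Some (t w))"
proof -
  have h: "definable M A (n + k) {x @ y |x y. h x = Some y}"
    "\<And>x y. h x = Some y \<Longrightarrow> length x = n"
    using assms(1) by (auto simp: definable_pfun_def tuples_def)
  have "definable_pred M A l (\<lambda>w. s w @ t w \<in> {x @ y |x y. h x = Some y})"
    by (rule definable_pred_mem[OF h(1) assms(2) coord_map_append[OF assms(3,4)]]) simp
  then show ?thesis
  proof (rule definable_pred_cong)
    fix w assume w: "w \<in> tuples (univ M) l"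
    have "x = s w \<and> y = t w" if "s w @ t w = x @ y" "h x = Some y" for x y
      using that h(2)[OF that(2)] length_coord_map[OF assms(3,2) w] by simp
    then show "s w @ t w \<in> {x @ y |x y. h x = Some y} \<longleftrightarrow> h (s w) = Some (t w)" by blast
  qed
qed

text \<open>
  The definability condition on cocycles, separated from the cocycle identity and with the arity of
  the values made explicit.
\<close>

definition definable_cochain ::
  "('f, 'r, 'm) fo_structure \<Rightarrow> 'm set \<Rightarrow> nat \<Rightarrow> (('m \<Rightarrow> 'm) \<Rightarrow> 'm list) \<Rightarrow> bool" where
  "definable_cochain M A k \<Phi> \<longleftrightarrow>
     (\<exists>m h. \<exists>a \<in> tuples (univ M) m. definable_pfun M A (m + m) k h \<and>
        (\<forall>\<sigma> \<in> Aut M A. h (a @ map \<sigma> a) = Some (\<Phi> \<sigma>)))"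

text \<open>
  Since a functional relation suffices, the values of a cochain may be characterized by an equation
  or through auxiliary elements instead of being computed by an explicit function.
\<close>

lemma definable_cochainI:
  assumes "a \<in> tuples (univ M) m"
    and "definable_pred M A (m + m + k) (\<lambda>v. R (take (m + m) v) (drop (m + m) v))"
    and "\<And>x y z. R x y \<Longrightarrow> R x z \<Longrightarrow> y = z"
    and "\<And>\<sigma>. \<sigma> \<in> Aut M A \<Longrightarrow> \<Phi> \<sigma> \<in> tuples (univ M) k \<and> R (a @ map \<sigma> a) (\<Phi> \<sigma>)"
  shows "definable_cochain M A k \<Phi>"
proof -
  obtain h where h: "definable_pfun M A (m + m) k h"
    "\<And>x y. x \<in> tuples (univ M) (m + m) \<Longrightarrow> y \<in> tuples (univ M) k \<Longrightarrow> R x y \<Longrightarrow> h x = Some y"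
    using ex_definable_pfun[of M A "m + m" k R] assms(2,3) by blast
  have "h (a @ map \<sigma> a) = Some (\<Phi> \<sigma>)" if "\<sigma> \<in> Aut M A" for \<sigma>
    using h(2) assms(4)[OF that] Aut_tuples[OF that assms(1)] assms(1)
    by (simp add: tuples_append tuples_length)
  then show ?thesis using h(1) assms(1) unfolding definable_cochain_def by blast
qed

lemma definable_cochain_cong:
  "definable_cochain M A k \<Phi> \<Longrightarrow> (\<And>\<sigma>. \<sigma> \<in> Aut M A \<Longrightarrow> \<Psi> \<sigma> = \<Phi> \<sigma>) \<Longrightarrow> definable_cochain M A k \<Psi>"
  unfolding definable_cochain_def by simp

lemma definable_cochain_map:
  assumes "definable_cochain M A n \<Phi>" "A \<subseteq> univ M" "definable_map M A n k X Y f"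
    and "\<Phi> \<in> Aut M A \<rightarrow> X"
  shows "definable_cochain M A k (\<lambda>\<sigma>. f (\<Phi> \<sigma>))"
proof -
  obtain m h a where a: "a \<in> tuples (univ M) m" and h: "definable_pfun M A (m + m) n h"
    and \<Phi>: "\<And>\<sigma>. \<sigma> \<in> Aut M A \<Longrightarrow> h (a @ map \<sigma> a) = Some (\<Phi> \<sigma>)"
    using assms(1) unfolding definable_cochain_def by blast
  let ?R = "\<lambda>x z. \<exists>p \<in> tuples (univ M) n. h x = Some p \<and> p \<in> X \<and> z = f p"
  have f: "X \<subseteq> tuples (univ M) n" "f ` X \<subseteq> tuples (univ M) k"
    using assms(3) by (simp_all add: definable_map_iff)
  show ?thesis
  proof (rule definable_cochainI[OF a, where R = ?R])
    show "definable_pred M A (m + m + k) (\<lambda>v. ?R (take (m + m) v) (drop (m + m) v))"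
      by (rule definable_pred_ex definable_pred_map[OF assms(3,2)]
          definable_pred_pfun[OF h assms(2)] definable_pred_and coord_map_intros | simp)+
  qed (use \<Phi> assms(4) f in \<open>auto simp: Pi_iff\<close>)
qed

text \<open>
  Only a single group is fixed, so that the locale can be interpreted for \<open>G\<close>, \<open>N\<close> and \<open>G/N\<close> alike.
\<close>

locale definable_group_over = group G
  for G :: "('m list) monoid" (structure) +
  fixes M :: "('f, 'r, 'm) fo_structure" and A :: "'m set" and n :: nat
  assumes structure_M: "is_structure M" and A_subset: "A \<subseteq> univ M"
    and definable_G: "definable_group M A n G"
begin

lemma definable_carrier: "definable M A n (carrier G)"
  and definable_mult:
    "definable M A (n + n + n) {x @ y @ (x \<otimes> y) |x y. x \<in> carrier G \<and> y \<in> carrier G}"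
  using definable_G by (simp_all add: definable_group_def)

lemma carrier_tuples: "x \<in> carrier G \<Longrightarrow> x \<in> tuples (univ M) n"
  using definable_carrier by (auto simp: definable_iff_pred)

lemma mult_graph_mem:
  assumes "length x = n" "length y = n"
  shows "x @ y @ z \<in> {x @ y @ (x \<otimes> y) |x y. x \<in> carrier G \<and> y \<in> carrier G} \<longleftrightarrow>
    x \<in> carrier G \<and> y \<in> carrier G \<and> z = x \<otimes> y"
proof
  assume "x @ y @ z \<in> {x @ y @ (x \<otimes> y) |x y. x \<in> carrier G \<and> y \<in> carrier G}"
  then obtain x' y' where *: "x @ y @ z = x' @ y' @ (x' \<otimes> y')" "x' \<in> carrier G" "y' \<in> carrier G"
    by blast
  then have "length x' = length x" "length y' = length y"
    using assms tuples_length[OF carrier_tuples] by simp_all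
  then show "x \<in> carrier G \<and> y \<in> carrier G \<and> z = x \<otimes> y" using * by simp
qed blast

lemma definable_pred_mult:
  assumes "coord_map M A l n s" "coord_map M A l n t" "coord_map M A l n u"
  shows "definable_pred M A l (\<lambda>w. s w \<in> carrier G \<and> t w \<in> carrier G \<and> u w = s w \<otimes> t w)"
proof -
  have "definable_pred M A l (\<lambda>w. s w @ t w @ u w \<in>
      {x @ y @ (x \<otimes> y) |x y. x \<in> carrier G \<and> y \<in> carrier G})"
    by (rule definable_pred_mem[OF definable_mult A_subset
          coord_map_append[OF assms(1) coord_map_append[OF assms(2,3) refl]]]) simp
  then show ?thesis
    by (rule definable_pred_cong)
      (rule mult_graph_mem[OF length_coord_map[OF assms(1) A_subset] length_coord_map[OF assms(2) A_subset]])
qed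

lemma Aut_carrier: "\<sigma> \<in> Aut M A \<Longrightarrow> x \<in> carrier G \<Longrightarrow> map \<sigma> x \<in> carrier G"
  by (rule definable_Aut[OF structure_M A_subset definable_carrier])

lemma Aut_mult:
  assumes "\<sigma> \<in> Aut M A" "x \<in> carrier G" "y \<in> carrier G"
  shows "map \<sigma> (x \<otimes> y) = map \<sigma> x \<otimes> map \<sigma> y"
proof -
  have "map \<sigma> (x @ y @ (x \<otimes> y)) \<in> {x @ y @ (x \<otimes> y) |x y. x \<in> carrier G \<and> y \<in> carrier G}"
    by (rule definable_Aut[OF structure_M A_subset definable_mult assms(1)]) (use assms in blast)
  then show ?thesis
    using mult_graph_mem[of "map \<sigma> x" "map \<sigma> y" "map \<sigma> (x \<otimes> y)"]
      tuples_length[OF carrier_tuples[OF assms(2)]] tuples_length[OF carrier_tuples[OF assms(3)]]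
    by simp
qed

lemma Aut_one: "\<sigma> \<in> Aut M A \<Longrightarrow> map \<sigma> \<one> = \<one>"
  using Aut_mult[of \<sigma> \<one> \<one>] Aut_carrier[of \<sigma> \<one>] r_cancel_one[of "map \<sigma> \<one>" "map \<sigma> \<one>"] by simp

lemma Aut_inv:
  assumes "\<sigma> \<in> Aut M A" "x \<in> carrier G"
  shows "map \<sigma> (inv x) = inv (map \<sigma> x)"
  using Aut_mult[OF assms(1), of "inv x" x] Aut_one[OF assms(1)] Aut_carrier[OF assms(1)] assms(2)
  by (intro inv_equality[symmetric]) simp_all

abbreviation Z where "Z \<equiv> Z1 M A G"
abbreviation coh where "coh \<equiv> cohomologous M A G"
abbreviation cl where "cl \<equiv> H1_class M A G"
abbreviation triv where "triv \<equiv> \<lambda>\<sigma> \<in> Aut M A. \<one>"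

text \<open>
  In the definition of cocycles the arity \<open>k\<close> of the values of \<open>h\<close> is arbitrary. It has to be \<open>n\<close>
  because \<open>h\<close> attains the value of the cocycle at the identity automorphism, an element of \<open>G\<close>.
\<close>

lemma Z1_iff:
  "\<Phi> \<in> Z \<longleftrightarrow> \<Phi> \<in> Aut M A \<rightarrow>\<^sub>E carrier G \<and>
     (\<forall>\<sigma> \<in> Aut M A. \<forall>\<tau> \<in> Aut M A. \<Phi> (\<sigma> \<circ> \<tau>) = \<Phi> \<sigma> \<otimes> map \<sigma> (\<Phi> \<tau>)) \<and>
     definable_cochain M A n \<Phi>"
proof -
  have "k = n" if "\<Phi> \<in> Aut M A \<rightarrow>\<^sub>E carrier G" "definable_pfun M A (m + m) k h"
    "\<forall>\<sigma> \<in> Aut M A. h (a @ map \<sigma> a) = Some (\<Phi> \<sigma>)" for m k h a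
  proof -
    have "h (a @ map id a) = Some (\<Phi> id)" using that(3) Aut_id by blast
    then have "length (\<Phi> id) = k"
      using that(2) unfolding definable_pfun_def by (blast dest: tuples_length)
    moreover have "length (\<Phi> id) = n"
      using that(1) Aut_id by (intro tuples_length[OF carrier_tuples]) blast
    ultimately show ?thesis by simp
  qed
  then show ?thesis unfolding Z1_def definable_cochain_def by blast
qed

lemma Z1_in: "\<Phi> \<in> Z \<Longrightarrow> \<sigma> \<in> Aut M A \<Longrightarrow> \<Phi> \<sigma> \<in> carrier G"
  unfolding Z1_iff by blast

lemma Z1_comp: "\<Phi> \<in> Z \<Longrightarrow> \<sigma> \<in> Aut M A \<Longrightarrow> \<tau> \<in> Aut M A \<Longrightarrow> \<Phi> (\<sigma> \<circ> \<tau>) = \<Phi> \<sigma> \<otimes> map \<sigma> (\<Phi> \<tau>)"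
  unfolding Z1_iff by blast

lemma Z1_restrict: "\<Phi> \<in> Z \<Longrightarrow> (\<lambda>\<sigma> \<in> Aut M A. \<Phi> \<sigma>) = \<Phi>"
  unfolding Z1_iff by (auto simp: PiE_restrict)

text \<open>
  The set consisting of the identity is definable because the identity is the only idempotent of a
  group. No arguments are needed to compute a constant, whence the empty tuple.
\<close>

lemma trivial_in_Z1: "triv \<in> Z"
proof -
  have "definable_cochain M A n (\<lambda>\<sigma>. \<one>)"
  proof (rule definable_cochainI[where a = "[]" and m = 0
        and R = "\<lambda>x z. z \<in> carrier G \<and> z \<in> carrier G \<and> z = z \<otimes> z"])
    show "definable_pred M A (0 + 0 + n) (\<lambda>v. drop (0 + 0) v \<in> carrier G \<and>
        drop (0 + 0) v \<in> carrier G \<and> drop (0 + 0) v = drop (0 + 0) v \<otimes> drop (0 + 0) v)"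
      by (rule definable_pred_mult coord_map_intros | simp)+
    show "[] \<in> tuples (univ M) 0" by (simp add: tuples_def)
  next
    fix y z :: "'m list"
    assume "y \<in> carrier G \<and> y \<in> carrier G \<and> y = y \<otimes> y" "z \<in> carrier G \<and> z \<in> carrier G \<and> z = z \<otimes> z"
    then show "y = z" using l_cancel_one[of y y] l_cancel_one[of z z] by simp
  qed (simp add: carrier_tuples)
  then have "definable_cochain M A n triv" by (rule definable_cochain_cong) simp
  then show ?thesis unfolding Z1_iff by (auto simp: Aut_comp Aut_one)
qed

text \<open>
  If \<open>h\<close> computes \<open>\<Phi>\<close> from the tuple \<open>a\<close>, then the twist is computed from \<open>a @ b\<close>. Its value \<open>z\<close> is
  characterized by \<open>b z = p \<sigma>(b)\<close> with \<open>p = \<Phi>(\<sigma>)\<close>, which only mentions \<open>h\<close> and the multiplication.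
\<close>

lemma definable_cochain_twist:
  assumes "definable_cochain M A n \<Phi>" "\<Phi> \<in> Aut M A \<rightarrow> carrier G" "b \<in> carrier G"
  shows "definable_cochain M A n (\<lambda>\<sigma>. inv b \<otimes> \<Phi> \<sigma> \<otimes> map \<sigma> b)"
proof -
  obtain m h a where a: "a \<in> tuples (univ M) m" and h: "definable_pfun M A (m + m) n h"
    and \<Phi>: "\<And>\<sigma>. \<sigma> \<in> Aut M A \<Longrightarrow> h (a @ map \<sigma> a) = Some (\<Phi> \<sigma>)"
    using assms(1) unfolding definable_cochain_def by blast
  \<comment> \<open>The argument \<open>v\<close> consists of four blocks \<open>a\<close>, \<open>b\<close>, \<open>\<sigma>(a)\<close>, \<open>\<sigma>(b)\<close> of lengths \<open>m\<close>, \<open>n\<close>, \<open>m\<close>, \<open>n\<close>.\<close>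
  let ?u = "\<lambda>v. take n (drop m v)" and ?w = "\<lambda>v. drop (m + n + m) v"
  let ?xy = "\<lambda>v. take m v @ take m (drop (m + n) v)"
  let ?R = "\<lambda>v z. \<exists>p \<in> tuples (univ M) n. h (?xy v) = Some p \<and>
     (\<exists>q \<in> tuples (univ M) n. (?u v \<in> carrier G \<and> z \<in> carrier G \<and> q = ?u v \<otimes> z) \<and>
        (p \<in> carrier G \<and> ?w v \<in> carrier G \<and> q = p \<otimes> ?w v))"
  show ?thesis
  proof (rule definable_cochainI[where a = "a @ b" and m = "m + n" and R = ?R])
    show "a @ b \<in> tuples (univ M) (m + n)"
      using a carrier_tuples[OF assms(3)] by (simp add: tuples_append tuples_length)
    show "definable_pred M A (m + n + (m + n) + n)
        (\<lambda>v. ?R (take (m + n + (m + n)) v) (drop (m + n + (m + n)) v))"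
      by (rule definable_pred_ex definable_pred_mult definable_pred_pfun[OF h A_subset]
          definable_pred_and coord_map_intros | simp)+
  next
    fix v z z' assume "?R v z" "?R v z'"
    then have "?u v \<otimes> z = ?u v \<otimes> z'" "?u v \<in> carrier G" "z \<in> carrier G" "z' \<in> carrier G" by auto
    then show "z = z'" by simp
  next
    fix \<sigma> assume \<sigma>: "\<sigma> \<in> Aut M A"
    let ?z = "inv b \<otimes> \<Phi> \<sigma> \<otimes> map \<sigma> b" and ?v = "(a @ b) @ map \<sigma> (a @ b)"
    have in_G: "\<Phi> \<sigma> \<in> carrier G" "map \<sigma> b \<in> carrier G" "?z \<in> carrier G"
      using assms(2,3) \<sigma> Aut_carrier by (auto simp: Pi_iff)
    have len: "length a = m" "length b = n"
      using a carrier_tuples[OF assms(3)] by (simp_all add: tuples_def)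
    have "b \<otimes> ?z = \<Phi> \<sigma> \<otimes> map \<sigma> b"
      using in_G assms(3) by (simp add: m_assoc inv_solve_left flip: m_assoc)
    moreover have "?xy ?v = a @ map \<sigma> a" "?u ?v = b" "?w ?v = map \<sigma> b" using len by simp_all
    ultimately have "?R ?v ?z"
      using \<Phi>[OF \<sigma>] in_G assms(3) carrier_tuples m_closed[OF in_G(1,2)] by auto
    then show "?z \<in> tuples (univ M) n \<and> ?R ?v ?z" using carrier_tuples in_G by blast
  qed
qed

text \<open>
  In the product of the values at \<open>\<sigma>\<close> and \<open>\<tau>\<close> the inner factors \<open>\<sigma>(b)\<close> and \<open>\<sigma>(b)\<^sup>-\<^sup>1\<close> cancel.
\<close>

lemma twist_in_Z1:
  assumes "\<Phi> \<in> Z" "b \<in> carrier G"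
  shows "(\<lambda>\<sigma> \<in> Aut M A. inv b \<otimes> \<Phi> \<sigma> \<otimes> map \<sigma> b) \<in> Z" (is "?\<Psi> \<in> Z")
  unfolding Z1_iff
proof (intro conjI ballI)
  show "?\<Psi> \<in> Aut M A \<rightarrow>\<^sub>E carrier G" using Z1_in[OF assms(1)] assms(2) Aut_carrier
    by (auto simp del: map_map)
  have "definable_cochain M A n (\<lambda>\<sigma>. inv b \<otimes> \<Phi> \<sigma> \<otimes> map \<sigma> b)"
    using assms(1) unfolding Z1_iff by (intro definable_cochain_twist assms(2)) auto
  then show "definable_cochain M A n ?\<Psi>" by (rule definable_cochain_cong) simp
next
  fix \<sigma> \<tau> assume \<sigma>: "\<sigma> \<in> Aut M A" and \<tau>: "\<tau> \<in> Aut M A"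
  let ?p = "\<Phi> \<sigma>" and ?q = "map \<sigma> (\<Phi> \<tau>)" and ?b = "map \<sigma> b" and ?c = "map \<sigma> (map \<tau> b)"
  have in_G: "?p \<in> carrier G" "?q \<in> carrier G" "?b \<in> carrier G" "?c \<in> carrier G"
    using Z1_in[OF assms(1)] Aut_carrier \<sigma> \<tau> assms(2) by (auto simp del: map_map)
  have "map \<sigma> (?\<Psi> \<tau>) = inv ?b \<otimes> ?q \<otimes> ?c"
    using \<sigma> \<tau> assms Z1_in[OF assms(1)] Aut_carrier[OF \<tau>]
    by (simp add: Aut_mult Aut_inv del: map_map)
  moreover have "?\<Psi> (\<sigma> \<circ> \<tau>) = inv b \<otimes> (?p \<otimes> ?q) \<otimes> ?c"
    using Aut_comp[OF \<sigma> \<tau>] Z1_comp[OF assms(1) \<sigma> \<tau>] by simp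
  moreover have "inv b \<otimes> ?p \<otimes> ?b \<otimes> (inv ?b \<otimes> ?q \<otimes> ?c) = inv b \<otimes> (?p \<otimes> ?q) \<otimes> ?c"
  proof -
    have "?b \<otimes> (inv ?b \<otimes> (?q \<otimes> ?c)) = ?q \<otimes> ?c"
      using in_G by (simp flip: m_assoc)
    then show ?thesis using in_G assms(2) by (simp add: m_assoc)
  qed
  ultimately show "?\<Psi> (\<sigma> \<circ> \<tau>) = ?\<Psi> \<sigma> \<otimes> map \<sigma> (?\<Psi> \<tau>)" using \<sigma> by simp
qed

lemma coh_iff:
  "(\<Phi>, \<Psi>) \<in> coh \<longleftrightarrow> \<Phi> \<in> Z \<and> \<Psi> \<in> Z \<and>
     (\<exists>b \<in> carrier G. \<forall>\<sigma> \<in> Aut M A. \<Psi> \<sigma> = inv b \<otimes> \<Phi> \<sigma> \<otimes> map \<sigma> b)"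
  by (simp add: cohomologous_def)

text \<open>
  Twisting by \<open>b\<close> is undone by twisting by \<open>b\<^sup>-\<^sup>1\<close>, and successive twists by \<open>b\<close> and \<open>c\<close> amount to one
  twist by \<open>b c\<close>.
\<close>

lemma equiv_coh: "equiv Z coh"
proof (rule equivI)
  show "coh \<subseteq> Z \<times> Z" by (auto simp: coh_iff)
  show "refl_on Z coh"
  proof (rule refl_onI)
    fix \<Phi> assume "\<Phi> \<in> Z"
    then show "(\<Phi>, \<Phi>) \<in> coh"
      unfolding coh_iff by (auto intro!: bexI[of _ \<one>] simp: Aut_one Z1_in)
  qed
  show "sym coh"
  proof (rule symI)
    fix \<Phi> \<Psi> assume "(\<Phi>, \<Psi>) \<in> coh"
    then obtain b where *: "\<Phi> \<in> Z" "\<Psi> \<in> Z" "b \<in> carrier G"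
      "\<And>\<sigma>. \<sigma> \<in> Aut M A \<Longrightarrow> \<Psi> \<sigma> = inv b \<otimes> \<Phi> \<sigma> \<otimes> map \<sigma> b" unfolding coh_iff by blast
    have "\<Phi> \<sigma> = inv (inv b) \<otimes> \<Psi> \<sigma> \<otimes> map \<sigma> (inv b)" if "\<sigma> \<in> Aut M A" for \<sigma>
    proof -
      have "\<Psi> \<sigma> \<otimes> inv (map \<sigma> b) = inv b \<otimes> \<Phi> \<sigma>"
        using *(4)[OF that] Z1_in[OF *(1) that] Aut_carrier[OF that *(3)] *(3)
        by (simp add: m_assoc)
      then have "b \<otimes> (\<Psi> \<sigma> \<otimes> inv (map \<sigma> b)) = \<Phi> \<sigma>"
        using Z1_in[OF *(1) that] *(3) by (simp flip: m_assoc)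
      then show ?thesis
        using Z1_in[OF *(2) that] Aut_carrier[OF that *(3)] *(3) by (simp add: Aut_inv that m_assoc)
    qed
    then show "(\<Psi>, \<Phi>) \<in> coh" unfolding coh_iff using * by blast
  qed
  show "trans coh"
  proof (rule transI)
    fix \<Phi> \<Psi> \<Theta> assume "(\<Phi>, \<Psi>) \<in> coh" "(\<Psi>, \<Theta>) \<in> coh"
    then obtain b c where *: "\<Phi> \<in> Z" "\<Psi> \<in> Z" "\<Theta> \<in> Z" "b \<in> carrier G" "c \<in> carrier G"
      "\<And>\<sigma>. \<sigma> \<in> Aut M A \<Longrightarrow> \<Psi> \<sigma> = inv b \<otimes> \<Phi> \<sigma> \<otimes> map \<sigma> b"
      "\<And>\<sigma>. \<sigma> \<in> Aut M A \<Longrightarrow> \<Theta> \<sigma> = inv c \<otimes> \<Psi> \<sigma> \<otimes> map \<sigma> c" unfolding coh_iff by blast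
    have "\<Theta> \<sigma> = inv (b \<otimes> c) \<otimes> \<Phi> \<sigma> \<otimes> map \<sigma> (b \<otimes> c)" if "\<sigma> \<in> Aut M A" for \<sigma>
      using *(4-7) that Z1_in[OF *(1) that] Aut_carrier[OF that]
      by (simp add: m_assoc inv_mult_group Aut_mult)
    then show "(\<Phi>, \<Theta>) \<in> coh" unfolding coh_iff using * by blast
  qed
qed

lemma H1_class_eq_iff: "\<Phi> \<in> Z \<Longrightarrow> \<Psi> \<in> Z \<Longrightarrow> cl \<Phi> = cl \<Psi> \<longleftrightarrow> (\<Phi>, \<Psi>) \<in> coh"
  unfolding H1_class_def by (rule eq_equiv_class_iff[OF equiv_coh])

lemma H1_eq: "H1 M A G = (cl ` Z, cl triv)"
  unfolding H1_def H1_class_def quotient_def by auto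

lemma H1_class_trivial_iff:
  assumes "\<Phi> \<in> Z"
  shows "cl \<Phi> = cl triv \<longleftrightarrow> (\<exists>b \<in> carrier G. \<forall>\<sigma> \<in> Aut M A. \<Phi> \<sigma> = inv b \<otimes> map \<sigma> b)"
proof -
  have "cl \<Phi> = cl triv \<longleftrightarrow> (triv, \<Phi>) \<in> coh"
    using H1_class_eq_iff[OF trivial_in_Z1 assms] by auto
  then show ?thesis by (simp add: coh_iff assms trivial_in_Z1)
qed

end

section \<open>Functoriality of the first cohomology\<close>

text \<open>
  Preservation of definable cochains is assumed instead of definability of \<open>f\<close>: for the inclusion of
  a subgroup it is immediate, as the same function \<open>h\<close> serves for both groups, and for a projection it
  follows from \<open>definable_cochain_map\<close>.
\<close>

locale definable_group_morphism =
  G: definable_group_over G M A n + H: definable_group_over H M A k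
  for G :: "('m list) monoid" (structure) and H :: "('m list) monoid"
    and M :: "('f, 'r, 'm) fo_structure" and A :: "'m set" and n k :: nat +
  fixes f :: "'m list \<Rightarrow> 'm list"
  assumes f_hom: "f \<in> hom G H"
    and f_Aut: "\<sigma> \<in> Aut M A \<Longrightarrow> x \<in> carrier G \<Longrightarrow> f (map \<sigma> x) = map \<sigma> (f x)"
    and f_cochain: "\<Phi> \<in> Aut M A \<rightarrow> carrier G \<Longrightarrow> definable_cochain M A n \<Phi> \<Longrightarrow>
      definable_cochain M A k (\<lambda>\<sigma>. f (\<Phi> \<sigma>))"
begin

sublocale group_hom G H f
  by unfold_locales (rule f_hom)

abbreviation push where "push \<Phi> \<equiv> \<lambda>\<sigma> \<in> Aut M A. f (\<Phi> \<sigma>)"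

lemma push_in_Z1:
  assumes "\<Phi> \<in> G.Z"
  shows "push \<Phi> \<in> H.Z"
  unfolding H.Z1_iff
proof (intro conjI ballI)
  show "push \<Phi> \<in> Aut M A \<rightarrow>\<^sub>E carrier H" using G.Z1_in[OF assms] by auto
  have "definable_cochain M A k (\<lambda>\<sigma>. f (\<Phi> \<sigma>))"
    using assms unfolding G.Z1_iff by (intro f_cochain) auto
  then show "definable_cochain M A k (push \<Phi>)" by (rule definable_cochain_cong) simp
next
  fix \<sigma> \<tau> assume "\<sigma> \<in> Aut M A" "\<tau> \<in> Aut M A"
  then show "push \<Phi> (\<sigma> \<circ> \<tau>) = push \<Phi> \<sigma> \<otimes>\<^bsub>H\<^esub> map \<sigma> (push \<Phi> \<tau>)"
    using G.Z1_in[OF assms] G.Z1_comp[OF assms] by (simp add: Aut_comp G.Aut_carrier f_Aut)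
qed

lemma push_coh:
  assumes "(\<Phi>, \<Psi>) \<in> G.coh"
  shows "(push \<Phi>, push \<Psi>) \<in> H.coh"
proof -
  obtain b where *: "\<Phi> \<in> G.Z" "\<Psi> \<in> G.Z" "b \<in> carrier G"
    "\<And>\<sigma>. \<sigma> \<in> Aut M A \<Longrightarrow> \<Psi> \<sigma> = inv b \<otimes> \<Phi> \<sigma> \<otimes> map \<sigma> b" using assms unfolding G.coh_iff by blast
  have "f (\<Psi> \<sigma>) = inv\<^bsub>H\<^esub> f b \<otimes>\<^bsub>H\<^esub> f (\<Phi> \<sigma>) \<otimes>\<^bsub>H\<^esub> map \<sigma> (f b)" if "\<sigma> \<in> Aut M A" for \<sigma>
    using *(3) *(4)[OF that] G.Z1_in[OF *(1) that] G.Aut_carrier[OF that *(3)]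
    by (simp add: f_Aut that)
  then show ?thesis
    unfolding H.coh_iff using * push_in_Z1 by (auto intro!: bexI[of _ "f b"])
qed

text \<open>
  The images of all representatives of a class are cohomologous, so \<open>the_elem\<close> in the definition of
  the induced map is applied to a singleton.
\<close>

lemma H1_map_class:
  assumes "\<Phi> \<in> G.Z"
  shows "H1_map M A H f (G.cl \<Phi>) = H.cl (push \<Phi>)"
proof -
  have "H.cl (push \<Psi>) = H.cl (push \<Phi>)" if "\<Psi> \<in> G.cl \<Phi>" for \<Psi>
  proof -
    have "(\<Phi>, \<Psi>) \<in> G.coh" using that by (simp add: H1_class_def)
    then have "(push \<Phi>, push \<Psi>) \<in> H.coh" by (rule push_coh)
    then show ?thesis using H.H1_class_eq_iff by (metis H.coh_iff)
  qed
  moreover have "\<Phi> \<in> G.cl \<Phi>"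
    unfolding H1_class_def by (rule equiv_class_self[OF G.equiv_coh assms])
  ultimately have "{H.cl (push \<Psi>) |\<Psi>. \<Psi> \<in> G.cl \<Phi>} = {H.cl (push \<Phi>)}" by blast
  then show ?thesis unfolding H1_map_def by simp
qed

lemma push_triv: "push G.triv = H.triv"
  by (rule ext) simp

lemma pointed_H1_map: "pointed_map (H1 M A G) (H1 M A H) (H1_map M A H f)"
  unfolding pointed_map_def G.H1_eq H.H1_eq
  using H1_map_class push_in_Z1 G.trivial_in_Z1 push_triv by auto

end

section \<open>Definable subgroups and their coset spaces\<close>

locale definable_subgroup = definable_group_over G M A n
  for G :: "('m list) monoid" (structure) and M :: "('f, 'r, 'm) fo_structure"
    and A :: "'m set" and n :: nat +
  fixes N :: "'m list set"
  assumes subgroup_N: "subgroup N G" and definable_N: "definable M A n N"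
begin

lemma N_carrier: "x \<in> N \<Longrightarrow> x \<in> carrier G"
  using subgroup.mem_carrier[OF subgroup_N] .

lemma definable_group_N: "definable_group M A n (G\<lparr>carrier := N\<rparr>)"
proof -
  let ?R = "\<lambda>x y z. x \<in> N \<and> y \<in> N \<and> x \<in> carrier G \<and> y \<in> carrier G \<and> z = x \<otimes> y"
  have "definable M A (n + n + n) {x @ y @ z |x y z. ?R x y z}"
  proof (rule definable_concat3I)
    show "definable_pred M A (n + n + n) (\<lambda>v. ?R (take n v) (take n (drop n v)) (drop (n + n) v))"
      by (rule definable_pred_mult definable_pred_mem[OF definable_N A_subset]
          definable_pred_and coord_map_intros | simp)+
  qed (auto intro: carrier_tuples)
  moreover have "{x @ y @ z |x y z. ?R x y z} = {x @ y @ (x \<otimes> y) |x y. x \<in> N \<and> y \<in> N}"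
    using N_carrier by blast
  ultimately show ?thesis
    unfolding definable_group_def
    using definable_N subgroup.subgroup_is_group[OF subgroup_N is_group] by simp
qed

sublocale GN: definable_group_over "G\<lparr>carrier := N\<rparr>" M A n
  using definable_group_N structure_M A_subset
  by (intro definable_group_over.intro definable_group_over_axioms.intro) (simp_all add: definable_group_def)

sublocale incl: definable_group_morphism "G\<lparr>carrier := N\<rparr>" G M A n n "\<lambda>x. x"
  by unfold_locales (auto simp: hom_def N_carrier)

text \<open>
  Shrinking the target does not affect definability, since the function \<open>h\<close> stays the same.
\<close>

lemma GN_Z1_iff: "\<Phi> \<in> GN.Z \<longleftrightarrow> \<Phi> \<in> Z \<and> \<Phi> \<in> Aut M A \<rightarrow> N"
  unfolding GN.Z1_iff Z1_iff using N_carrier by (fastforce simp: PiE_iff Pi_iff)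

lemma H1_map_incl: "\<Phi> \<in> GN.Z \<Longrightarrow> H1_map M A G (\<lambda>x. x) (GN.cl \<Phi>) = cl \<Phi>"
  using incl.H1_map_class GN.Z1_restrict by simp

lemma inv_N: "x \<in> N \<Longrightarrow> inv\<^bsub>G\<lparr>carrier := N\<rparr>\<^esub> x = inv x"
  by (rule m_inv_consistent[OF subgroup_N])

lemma lcoset_eq_iff:
  assumes "x \<in> carrier G" "y \<in> carrier G"
  shows "x <# N = y <# N \<longleftrightarrow> inv x \<otimes> y \<in> N"
proof
  assume *: "x <# N = y <# N"
  have "y \<otimes> \<one> \<in> y <# N"
    unfolding l_coset_def using subgroup.one_closed[OF subgroup_N] by blast
  then obtain u where "u \<in> N" "y = x \<otimes> u" unfolding *[symmetric] using assms by (auto simp: l_coset_def)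
  then show "inv x \<otimes> y \<in> N" using assms N_carrier by (simp flip: m_assoc)
next
  assume u: "inv x \<otimes> y \<in> N"
  let ?u = "inv x \<otimes> y"
  have "x \<otimes> v = y \<otimes> (inv ?u \<otimes> v)" "y \<otimes> v = x \<otimes> (?u \<otimes> v)" if "v \<in> N" for v
    using that assms N_carrier by (simp_all add: inv_mult_group flip: m_assoc)
  moreover have "inv ?u \<otimes> v \<in> N" "?u \<otimes> v \<in> N" if "v \<in> N" for v
    using u that subgroup_N by (simp_all add: subgroup.m_closed subgroup.m_inv_closed)
  ultimately show "x <# N = y <# N" unfolding l_coset_def by blast
qed

text \<open>
  Elimination of imaginaries is applied to pairs of a tuple \<open>x\<close> and a parameter tuple \<open>d\<close>, two of
  which are equivalent when the same tuples \<open>z\<close> satisfy \<open>S (x @ d) z\<close>. For the parameters \<open>c\<close> of \<open>N\<close> and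
  \<open>x\<close> in \<open>G\<close> these \<open>z\<close> form the coset \<open>x N\<close>, so fixing \<open>c\<close> in the resulting map yields the projection.
\<close>

lemma ex_coset_space:
  assumes "eliminates_imaginaries M"
  shows "\<exists>k Q \<pi>. is_coset_space M A n G N k Q \<pi>"
proof -
  define R where "R x z \<longleftrightarrow> (\<exists>u \<in> tuples (univ M) n. u \<in> N \<and> x \<in> carrier G \<and> u \<in> carrier G \<and> z = x \<otimes> u)"
    for x z
  have R_iff: "R x z \<longleftrightarrow> z \<in> x <# N" if "x \<in> carrier G" for x z
    unfolding R_def l_coset_def using that N_carrier carrier_tuples by blast
  have "definable_pred M A (n + n) (\<lambda>w. R (take n w) (drop n w))"
    unfolding R_def
    by (rule definable_pred_ex definable_pred_mult definable_pred_mem[OF definable_N A_subset]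
          definable_pred_and coord_map_intros | simp)+
  then obtain c P where c: "set c \<subseteq> A" and P: "definable_pred M {} (n + n + length c) P"
    and P_R: "\<And>w. w \<in> tuples (univ M) (n + n) \<Longrightarrow> P (w @ c) \<longleftrightarrow> R (take n w) (drop n w)"
    by (rule definable_pred_split_params) blast
  define l where "l = n + length c"
  \<comment> \<open>The variables of \<open>P\<close> are ordered \<open>x\<close>, \<open>z\<close>, \<open>c\<close>, whereas a pair is encoded as \<open>v = x @ c\<close>.\<close>
  define S where "S v z \<longleftrightarrow> P ((take n v @ z) @ drop n v)" for v z
  define E where "E = {(v, w). v \<in> tuples (univ M) l \<and> w \<in> tuples (univ M) l \<and>
    (\<forall>z \<in> tuples (univ M) n. S v z \<longleftrightarrow> S w z)}"
  have "equiv (tuples (univ M) l) E"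
    by (rule equivI) (auto simp: E_def refl_on_def sym_def trans_def)
  moreover have "definable M {} (l + l) {x @ y |x y. (x, y) \<in> E}"
  proof (rule definable_concatI)
    have "definable_pred M {} (l + l) (\<lambda>v. \<forall>z \<in> tuples (univ M) n. S (take l v) z \<longleftrightarrow> S (drop l v) z)"
      unfolding S_def l_def
      by (rule definable_pred_all definable_pred_iff definable_pred_comp[OF P]
          coord_map_intros | simp)+
    then show "definable_pred M {} (l + l) (\<lambda>v. (take l v, drop l v) \<in> E)"
      by (rule definable_pred_cong) (auto simp: E_def dest: tuples_appendD)
  qed (auto simp: E_def)
  ultimately obtain k f where
    f: "definable_map M {} l k (tuples (univ M) l) (tuples (univ M) k) f" and
    f_E: "\<And>x y. x \<in> tuples (univ M) l \<Longrightarrow> y \<in> tuples (univ M) l \<Longrightarrow> (x, y) \<in> E \<longleftrightarrow> f x = f y"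
    using assms unfolding eliminates_imaginaries_def by meson
  define \<pi> where "\<pi> x = f (x @ c)" for x
  define Q where "Q = \<pi> ` carrier G"
  have xc: "x @ c \<in> tuples (univ M) l" if "x \<in> carrier G" for x
    using carrier_tuples[OF that] c A_subset by (auto simp: tuples_def l_def)
  have f_A: "definable_map M A l k (tuples (univ M) l) (tuples (univ M) k) f"
    using f unfolding definable_map_iff by (blast intro: definable_mono)
  have Q_tuples: "Q \<subseteq> tuples (univ M) k"
    using f xc unfolding Q_def \<pi>_def definable_map_iff by blast
  have \<pi>_map: "definable_map M A n k (carrier G) Q \<pi>"
    unfolding definable_map_iff
  proof (intro conjI)
    let ?R = "\<lambda>x q. x \<in> carrier G \<and> x @ c \<in> tuples (univ M) l \<and> q = f (x @ c)"
    have "definable M A (n + k) {x @ q |x q. ?R x q}"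
    proof (rule definable_concatI)
      show "definable_pred M A (n + k) (\<lambda>v. ?R (take n v) (drop n v))"
        by (rule definable_pred_map[OF f_A A_subset] definable_pred_mem[OF definable_carrier A_subset]
          definable_pred_and coord_map_append coord_map_const[OF c] coord_map_intros
          | simp add: l_def)+
      show "\<And>x q. ?R x q \<Longrightarrow> x \<in> tuples (univ M) n \<and> q \<in> tuples (univ M) k"
        using carrier_tuples f unfolding definable_map_iff by blast
    qed
    moreover have "{x @ q |x q. ?R x q} = {x @ \<pi> x |x. x \<in> carrier G}"
      unfolding \<pi>_def using xc by blast
    ultimately show "definable M A (n + k) {x @ \<pi> x |x. x \<in> carrier G}" by simp
  qed (use Q_tuples carrier_tuples in \<open>auto simp: Q_def\<close>)
  have "definable M A k Q"
    unfolding definable_iff_pred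
  proof
    have "definable_pred M A k (\<lambda>q. \<exists>x \<in> tuples (univ M) n. x \<in> carrier G \<and> q = \<pi> x)"
      by (rule definable_pred_ex definable_pred_map[OF \<pi>_map A_subset] coord_map_intros | simp)+
    then show "definable_pred M A k (\<lambda>q. q \<in> Q)"
      by (rule definable_pred_cong) (auto simp: Q_def carrier_tuples)
  qed (rule Q_tuples)
  moreover have "\<pi> x = \<pi> y \<longleftrightarrow> x <# N = y <# N" if "x \<in> carrier G" "y \<in> carrier G" for x y
  proof -
    have S_coset: "S (x @ c) z \<longleftrightarrow> z \<in> x <# N" if "x \<in> carrier G" "z \<in> tuples (univ M) n" for x z
      using P_R[of "x @ z"] carrier_tuples[OF that(1)] that R_iff
      by (simp add: S_def tuples_append tuples_length)
    have "z \<in> tuples (univ M) n" if "z \<in> x <# N" "x \<in> carrier G" for x z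
      using that N_carrier carrier_tuples by (auto simp: l_coset_def)
    then have "(x @ c, y @ c) \<in> E \<longleftrightarrow> x <# N = y <# N"
      using S_coset that xc unfolding E_def by blast
    then show ?thesis using f_E xc that by (simp add: \<pi>_def)
  qed
  ultimately have "is_coset_space M A n G N k Q \<pi>"
    unfolding is_coset_space_def using \<pi>_map Q_def by blast
  then show ?thesis by blast
qed

end

section \<open>Exactness for a subgroup\<close>

locale definable_coset_space = definable_subgroup G M A n N
  for G :: "('m list) monoid" (structure) and M :: "('f, 'r, 'm) fo_structure"
    and A :: "'m set" and n :: nat and N :: "'m list set" +
  fixes k :: nat and Q :: "'m list set" and \<pi> :: "'m list \<Rightarrow> 'm list"
  assumes coset_space: "is_coset_space M A n G N k Q \<pi>"
begin

lemma definable_Q: "definable M A k Q"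
  and definable_\<pi>: "definable_map M A n k (carrier G) Q \<pi>"
  and \<pi>_image: "\<pi> ` carrier G = Q"
  using coset_space by (simp_all add: is_coset_space_def)

lemma \<pi>_eq_iff: "x \<in> carrier G \<Longrightarrow> y \<in> carrier G \<Longrightarrow> \<pi> x = \<pi> y \<longleftrightarrow> inv x \<otimes> y \<in> N"
  using coset_space lcoset_eq_iff unfolding is_coset_space_def by blast

lemma \<pi>_in: "x \<in> carrier G \<Longrightarrow> \<pi> x \<in> Q"
  using \<pi>_image by blast

lemma \<pi>_one_iff: "x \<in> carrier G \<Longrightarrow> \<pi> x = \<pi> \<one> \<longleftrightarrow> x \<in> N"
  using \<pi>_eq_iff[of \<one> x] by auto

lemma \<pi>_Aut: "\<sigma> \<in> Aut M A \<Longrightarrow> x \<in> carrier G \<Longrightarrow> \<pi> (map \<sigma> x) = map \<sigma> (\<pi> x)"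
  by (rule definable_map_Aut[OF structure_M A_subset definable_\<pi>])

text \<open>
  The coset of \<open>b\<close> is sent to the coset of \<open>\<sigma>(b)\<close>. This links invariant points of \<open>G/N\<close> with cocycles in \<open>N\<close>.
\<close>

lemma \<pi>_fixed_iff:
  "\<sigma> \<in> Aut M A \<Longrightarrow> b \<in> carrier G \<Longrightarrow> map \<sigma> (\<pi> b) = \<pi> b \<longleftrightarrow> inv b \<otimes> map \<sigma> b \<in> N"
  using \<pi>_eq_iff[of b "map \<sigma> b"] Aut_carrier[of \<sigma> b] by (auto simp: \<pi>_Aut)

abbreviation cob where "cob b \<equiv> \<lambda>\<sigma> \<in> Aut M A. inv b \<otimes> map \<sigma> b"

text \<open>
  The coboundary of \<open>b\<close> is the twist of the trivial cocycle by \<open>b\<close>, which is why it is definable.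
\<close>

lemma cob_in_Z1:
  assumes "b \<in> carrier G"
  shows "cob b \<in> Z"
proof -
  have "(\<lambda>\<sigma> \<in> Aut M A. inv b \<otimes> triv \<sigma> \<otimes> map \<sigma> b) = cob b" using assms by (auto simp: fun_eq_iff)
  then show ?thesis using twist_in_Z1[OF trivial_in_Z1 assms] by simp
qed

lemma cob_in_GN_Z1:
  assumes "b \<in> carrier G" "\<And>\<sigma>. \<sigma> \<in> Aut M A \<Longrightarrow> map \<sigma> (\<pi> b) = \<pi> b"
  shows "cob b \<in> GN.Z"
  unfolding GN_Z1_iff using cob_in_Z1[OF assms(1)] assms \<pi>_fixed_iff by auto

text \<open>
  Another representative of the coset is \<open>c = b u\<close> with \<open>u\<close> in \<open>N\<close>, and the coboundary of \<open>c\<close> is that of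
  \<open>b\<close> twisted by \<open>u\<close>. Both are therefore cohomologous in \<open>N\<close>.
\<close>

lemma connecting_map_class:
  assumes b: "b \<in> carrier G" and fixed: "\<And>\<sigma>. \<sigma> \<in> Aut M A \<Longrightarrow> map \<sigma> (\<pi> b) = \<pi> b"
  shows "connecting_map M A G N \<pi> (\<pi> b) = GN.cl (cob b)"
proof -
  have "GN.cl (cob c) = GN.cl (cob b)" if c: "c \<in> carrier G" "\<pi> c = \<pi> b" for c
  proof -
    let ?u = "inv b \<otimes> c"
    have u: "?u \<in> N" using \<pi>_eq_iff[OF b c(1)] c by auto
    have "cob c \<sigma> = inv ?u \<otimes> cob b \<sigma> \<otimes> map \<sigma> ?u" if \<sigma>: "\<sigma> \<in> Aut M A" for \<sigma>
    proof -
      have "map \<sigma> b \<otimes> (inv (map \<sigma> b) \<otimes> map \<sigma> c) = map \<sigma> c"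
        using b c Aut_carrier[OF \<sigma>] by (simp flip: m_assoc)
      moreover have "b \<otimes> (inv b \<otimes> map \<sigma> c) = map \<sigma> c"
        using b c Aut_carrier[OF \<sigma>] by (simp flip: m_assoc)
      ultimately show ?thesis
        using b c \<sigma> Aut_carrier[OF \<sigma>] by (simp add: Aut_mult Aut_inv inv_mult_group m_assoc)
    qed
    then have "(cob b, cob c) \<in> GN.coh"
      unfolding GN.coh_iff using u cob_in_GN_Z1 b c fixed by (auto simp: inv_N intro!: bexI[of _ ?u])
    then show ?thesis using GN.H1_class_eq_iff by (metis GN.coh_iff)
  qed
  then have "{GN.cl (cob c) |c. c \<in> carrier G \<and> \<pi> c = \<pi> b} = {GN.cl (cob b)}" using b by blast
  then show ?thesis unfolding connecting_map_def by simp
qed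

abbreviation fixpts where "fixpts X \<equiv> {x \<in> X. \<forall>\<sigma> \<in> Aut M A. map \<sigma> x = x}"

lemma fixpts_Q_cases:
  assumes "q \<in> fixpts Q"
  obtains b where "b \<in> carrier G" "q = \<pi> b" "\<And>\<sigma>. \<sigma> \<in> Aut M A \<Longrightarrow> map \<sigma> (\<pi> b) = \<pi> b"
proof -
  obtain b where "b \<in> carrier G" "q = \<pi> b" using assms \<pi>_image by blast
  then show thesis using assms by (intro that[of b]) auto
qed

lemma one_fix: "\<one> \<in> fixpts N" "\<one> \<in> fixpts (carrier G)" "\<pi> \<one> \<in> fixpts Q"
  using subgroup.one_closed[OF subgroup_N] \<pi>_in
  by (auto simp: Aut_one simp flip: \<pi>_Aut)

lemma exact_at_H0_N:
  "exact_at ({()}, ()) (\<lambda>_. \<one>) (H0 M A N \<one>) (H0_map M A N (\<lambda>x. x)) (H0 M A (carrier G) \<one>)"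
  using one_fix N_carrier by (auto simp: exact_at_def pointed_map_def H0_def H0_map_def)

lemma exact_at_H0_G:
  "exact_at (H0 M A N \<one>) (H0_map M A N (\<lambda>x. x)) (H0 M A (carrier G) \<one>)
     (H0_map M A (carrier G) \<pi>) (H0 M A Q (\<pi> \<one>))"
  using one_fix N_carrier \<pi>_in \<pi>_one_iff
  by (auto simp: exact_at_def pointed_map_def H0_def H0_map_def simp flip: \<pi>_Aut)

lemma connecting_map_one: "connecting_map M A G N \<pi> (\<pi> \<one>) = GN.cl GN.triv"
proof -
  have "cob \<one> = GN.triv" by (auto simp: fun_eq_iff Aut_one)
  then show ?thesis using connecting_map_class[of \<one>] one_fix(3) by simp
qed

lemma pointed_connecting_map:
  "pointed_map (H0 M A Q (\<pi> \<one>)) (H1 M A (G\<lparr>carrier := N\<rparr>)) (connecting_map M A G N \<pi>)"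
  unfolding pointed_map_def GN.H1_eq H0_def fst_conv snd_conv
proof
  show "connecting_map M A G N \<pi> \<in> fixpts Q \<rightarrow> GN.cl ` GN.Z"
  proof
    fix q assume "q \<in> fixpts Q"
    then show "connecting_map M A G N \<pi> q \<in> GN.cl ` GN.Z"
      by (rule fixpts_Q_cases) (simp add: connecting_map_class cob_in_GN_Z1)
  qed
qed (rule connecting_map_one)

text \<open>
  If the coboundary of \<open>b\<close> is trivial in \<open>N\<close>, say \<open>b\<^sup>-\<^sup>1 \<sigma>(b) = c\<^sup>-\<^sup>1 \<sigma>(c)\<close> with \<open>c\<close> in \<open>N\<close>, then \<open>b c\<^sup>-\<^sup>1\<close> is an
  invariant element of the coset of \<open>b\<close>.
\<close>

lemma exact_at_H0_Q:
  "exact_at (H0 M A (carrier G) \<one>) (H0_map M A (carrier G) \<pi>) (H0 M A Q (\<pi> \<one>))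
     (connecting_map M A G N \<pi>) (H1 M A (G\<lparr>carrier := N\<rparr>))"
proof -
  have "connecting_map M A G N \<pi> (\<pi> b) = GN.cl GN.triv"
    if "b \<in> fixpts (carrier G)" for b
  proof -
    have "cob b = GN.triv" using that by (auto simp: fun_eq_iff)
    then show ?thesis using that connecting_map_class[of b] by (simp flip: \<pi>_Aut)
  qed
  moreover have "q \<in> \<pi> ` fixpts (carrier G)"
    if q: "q \<in> fixpts Q" and *: "connecting_map M A G N \<pi> q = GN.cl GN.triv" for q
  proof -
    obtain b where b: "b \<in> carrier G" "q = \<pi> b" "\<And>\<sigma>. \<sigma> \<in> Aut M A \<Longrightarrow> map \<sigma> (\<pi> b) = \<pi> b"
      using fixpts_Q_cases[OF q] by blast
    have "GN.cl (cob b) = GN.cl GN.triv" using * connecting_map_class[OF b(1,3)] b(2) by simp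
    then have "\<exists>c \<in> carrier (G\<lparr>carrier := N\<rparr>). \<forall>\<sigma> \<in> Aut M A.
        cob b \<sigma> = inv\<^bsub>G\<lparr>carrier := N\<rparr>\<^esub> c \<otimes>\<^bsub>G\<lparr>carrier := N\<rparr>\<^esub> map \<sigma> c"
      using GN.H1_class_trivial_iff cob_in_GN_Z1[OF b(1,3)] by blast
    then obtain c where c: "c \<in> N" "\<And>\<sigma>. \<sigma> \<in> Aut M A \<Longrightarrow> inv b \<otimes> map \<sigma> b = inv c \<otimes> map \<sigma> c"
      by (auto simp: inv_N)
    let ?d = "b \<otimes> inv c"
    have c_in: "c \<in> carrier G" by (rule N_carrier[OF c(1)])
    have "map \<sigma> ?d = ?d" if \<sigma>: "\<sigma> \<in> Aut M A" for \<sigma>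
    proof -
      have "b \<otimes> (inv b \<otimes> map \<sigma> b) = b \<otimes> (inv c \<otimes> map \<sigma> c)" using c(2)[OF \<sigma>] by simp
      then have "map \<sigma> b = b \<otimes> inv c \<otimes> map \<sigma> c"
        using b(1) c_in Aut_carrier[OF \<sigma>] by (simp flip: m_assoc)
      then have "map \<sigma> b \<otimes> inv (map \<sigma> c) = b \<otimes> inv c"
        using b(1) c_in Aut_carrier[OF \<sigma>] by (simp add: m_assoc)
      then show ?thesis using b(1) c_in by (simp add: Aut_mult Aut_inv \<sigma>)
    qed
    moreover have "\<pi> ?d = q"
      using \<pi>_eq_iff[of b ?d] b c c_in subgroup.m_inv_closed[OF subgroup_N c(1)]
      by (simp flip: m_assoc)
    ultimately show ?thesis using b(1) c_in by force
  qed
  ultimately have "\<pi> ` fixpts (carrier G) = {q \<in> fixpts Q. connecting_map M A G N \<pi> q = GN.cl GN.triv}"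
    using \<pi>_in by (auto simp flip: \<pi>_Aut)
  moreover have "restrict \<pi> (fixpts (carrier G)) ` fixpts (carrier G) = \<pi> ` fixpts (carrier G)" by auto
  ultimately have main: "restrict \<pi> (fixpts (carrier G)) ` fixpts (carrier G) =
      {q \<in> fixpts Q. connecting_map M A G N \<pi> q = GN.cl GN.triv}" by (simp only:)
  have pointed: "pointed_map (H0 M A (carrier G) \<one>) (H0 M A Q (\<pi> \<one>)) (H0_map M A (carrier G) \<pi>)"
    using exact_at_H0_G unfolding exact_at_def by (elim conjE)
  show ?thesis
    unfolding exact_at_def GN.H1_eq H0_def H0_map_def fst_conv snd_conv
    by (intro conjI imageI one_fix GN.trivial_in_Z1 main pointed[unfolded H0_def H0_map_def]
        pointed_connecting_map[unfolded GN.H1_eq H0_def])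
qed

text \<open>
  A cocycle with values in \<open>N\<close> that is trivial in \<open>G\<close> is literally the coboundary of some \<open>b\<close> in \<open>G\<close>; since
  its values lie in \<open>N\<close>, the coset of \<open>b\<close> is invariant.
\<close>

lemma exact_at_H1_N:
  "exact_at (H0 M A Q (\<pi> \<one>)) (connecting_map M A G N \<pi>) (H1 M A (G\<lparr>carrier := N\<rparr>))
     (H1_map M A G (\<lambda>x. x)) (H1 M A G)"
proof -
  have "connecting_map M A G N \<pi> ` fixpts Q = {y \<in> GN.cl ` GN.Z. H1_map M A G (\<lambda>x. x) y = cl triv}"
  proof (intro Set.set_eqI iffI)
    fix y assume "y \<in> connecting_map M A G N \<pi> ` fixpts Q"
    then obtain q where q: "q \<in> fixpts Q" "y = connecting_map M A G N \<pi> q" by blast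
    obtain b where b: "b \<in> carrier G" "q = \<pi> b" "\<And>\<sigma>. \<sigma> \<in> Aut M A \<Longrightarrow> map \<sigma> (\<pi> b) = \<pi> b"
      using fixpts_Q_cases[OF q(1)] by blast
    have "cl (cob b) = cl triv"
      unfolding H1_class_trivial_iff[OF cob_in_Z1[OF b(1)]] using b(1) by auto
    then show "y \<in> {y \<in> GN.cl ` GN.Z. H1_map M A G (\<lambda>x. x) y = cl triv}"
      using q(2) b connecting_map_class[OF b(1,3)] cob_in_GN_Z1[OF b(1,3)] H1_map_incl by simp
  next
    fix y assume "y \<in> {y \<in> GN.cl ` GN.Z. H1_map M A G (\<lambda>x. x) y = cl triv}"
    then obtain \<Phi> where \<Phi>: "\<Phi> \<in> GN.Z" "y = GN.cl \<Phi>"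
      and "H1_map M A G (\<lambda>x. x) (GN.cl \<Phi>) = cl triv" by blast
    then have trivial: "cl \<Phi> = cl triv" by (simp only: H1_map_incl)
    have Z: "\<Phi> \<in> Z" "\<Phi> \<in> Aut M A \<rightarrow> N" using GN_Z1_iff[THEN iffD1, OF \<Phi>(1)] by simp_all
    obtain b where b: "b \<in> carrier G" "\<And>\<sigma>. \<sigma> \<in> Aut M A \<Longrightarrow> \<Phi> \<sigma> = inv b \<otimes> map \<sigma> b"
      using H1_class_trivial_iff[OF Z(1), THEN iffD1, OF trivial] by blast
    have fixed: "map \<sigma> (\<pi> b) = \<pi> b" if "\<sigma> \<in> Aut M A" for \<sigma>
      using \<pi>_fixed_iff[OF that b(1)] b(2)[OF that] Pi_mem[OF Z(2) that] by simp
    have "cob b = (\<lambda>\<sigma> \<in> Aut M A. \<Phi> \<sigma>)" by (rule restrict_ext) (rule b(2)[symmetric])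
    then have "cob b = \<Phi>" using GN.Z1_restrict[OF \<Phi>(1)] by simp
    then have "y = connecting_map M A G N \<pi> (\<pi> b)"
      using connecting_map_class[OF b(1) fixed] \<Phi>(2) by simp
    then show "y \<in> connecting_map M A G N \<pi> ` fixpts Q" using fixed \<pi>_in[OF b(1)] by blast
  qed
  then show ?thesis
    unfolding exact_at_def GN.H1_eq H1_eq H0_def fst_conv snd_conv
    by (intro conjI imageI one_fix GN.trivial_in_Z1 trivial_in_Z1
        pointed_connecting_map[unfolded GN.H1_eq H0_def] incl.pointed_H1_map[unfolded GN.H1_eq H1_eq])
qed

end

section \<open>Exactness for a normal subgroup\<close>

locale definable_quotient_group = definable_coset_space +
  assumes normal_N: "N \<lhd> G"
begin

abbreviation GQ where "GQ \<equiv> quotient_group G Q \<pi>"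

lemma carrier_GQ: "carrier GQ = Q" and one_GQ: "\<one>\<^bsub>GQ\<^esub> = \<pi> \<one>"
  by (simp_all add: quotient_group_def)

text \<open>
  This is where normality is used. If \<open>u\<close> and \<open>v\<close> are the representatives chosen for the cosets of \<open>x\<close>
  and \<open>y\<close>, then \<open>(u v)\<^sup>-\<^sup>1 x y\<close> is the product of \<open>v\<^sup>-\<^sup>1 y\<close> and the conjugate of \<open>u\<^sup>-\<^sup>1 x\<close> by \<open>y\<close>.
\<close>

lemma mult_GQ:
  assumes "x \<in> carrier G" "y \<in> carrier G"
  shows "\<pi> x \<otimes>\<^bsub>GQ\<^esub> \<pi> y = \<pi> (x \<otimes> y)"
proof -
  let ?x = "inv_into (carrier G) \<pi> (\<pi> x)" and ?y = "inv_into (carrier G) \<pi> (\<pi> y)"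
  have in_G: "?x \<in> carrier G" "?y \<in> carrier G" using assms by (auto intro!: inv_into_into)
  have "\<pi> ?x = \<pi> x" "\<pi> ?y = \<pi> y" using assms by (auto intro!: f_inv_into_f)
  then have *: "inv ?x \<otimes> x \<in> N" "inv ?y \<otimes> y \<in> N" using \<pi>_eq_iff in_G assms by blast+
  have "inv y \<otimes> (inv ?x \<otimes> x) \<otimes> y \<in> N"
    by (rule normal.inv_op_closed1[OF normal_N assms(2) *(1)])
  then have "(inv ?y \<otimes> y) \<otimes> (inv y \<otimes> (inv ?x \<otimes> x) \<otimes> y) \<in> N"
    by (rule subgroup.m_closed[OF subgroup_N *(2)])
  moreover have "(inv ?y \<otimes> y) \<otimes> (inv y \<otimes> (inv ?x \<otimes> x) \<otimes> y) = inv (?x \<otimes> ?y) \<otimes> (x \<otimes> y)"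
  proof -
    have "y \<otimes> (inv y \<otimes> (inv ?x \<otimes> (x \<otimes> y))) = inv ?x \<otimes> (x \<otimes> y)"
      using in_G assms by (simp flip: m_assoc)
    then show ?thesis using in_G assms by (simp add: m_assoc inv_mult_group)
  qed
  ultimately have "\<pi> (?x \<otimes> ?y) = \<pi> (x \<otimes> y)" using \<pi>_eq_iff in_G assms by simp
  then show ?thesis by (simp add: quotient_group_def)
qed

lemma \<pi>_hom: "\<pi> \<in> hom G GQ"
  unfolding hom_def using mult_GQ \<pi>_in by (auto simp: carrier_GQ)

lemma group_GQ: "group GQ"
proof -
  have "GQ\<lparr>carrier := \<pi> ` carrier G, one := \<pi> \<one>\<rparr> = GQ"
    using \<pi>_image by (simp add: quotient_group_def)
  then show ?thesis using hom_imp_img_group[OF \<pi>_hom] by simp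
qed

text \<open>
  The multiplication of the quotient is the image of that of \<open>G\<close> under the projection, hence
  definable by quantifying over representatives.
\<close>

lemma definable_group_GQ: "definable_group M A k GQ"
proof -
  let ?B = "\<lambda>x y z p q r. (x \<in> carrier G \<and> y \<in> carrier G \<and> z = x \<otimes> y) \<and>
    (x \<in> carrier G \<and> p = \<pi> x) \<and> (y \<in> carrier G \<and> q = \<pi> y) \<and> (z \<in> carrier G \<and> r = \<pi> z)"
  let ?R = "\<lambda>p q r. \<exists>x \<in> tuples (univ M) n. \<exists>y \<in> tuples (univ M) n. \<exists>z \<in> tuples (univ M) n.
    ?B x y z p q r"
  have "definable M A (k + k + k) {p @ q @ r |p q r. ?R p q r}"
  proof (rule definable_concat3I)
    show "definable_pred M A (k + k + k) (\<lambda>v. ?R (take k v) (take k (drop k v)) (drop (k + k) v))"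
      by (rule definable_pred_ex definable_pred_mult definable_pred_map[OF definable_\<pi> A_subset]
          definable_pred_and coord_map_intros | simp)+
    have "\<pi> x \<in> tuples (univ M) k" if "x \<in> carrier G" for x
      using definable_Q \<pi>_in[OF that] by (auto simp: definable_iff_pred)
    then show "\<And>p q r. ?R p q r \<Longrightarrow>
        p \<in> tuples (univ M) k \<and> q \<in> tuples (univ M) k \<and> r \<in> tuples (univ M) k" by blast
  qed
  moreover have "{p @ q @ r |p q r. ?R p q r} = {p @ q @ (p \<otimes>\<^bsub>GQ\<^esub> q) |p q. p \<in> Q \<and> q \<in> Q}"
  proof -
    have "?R p q r \<longleftrightarrow> p \<in> Q \<and> q \<in> Q \<and> r = p \<otimes>\<^bsub>GQ\<^esub> q" for p q r
    proof
      assume "?R p q r"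
      then show "p \<in> Q \<and> q \<in> Q \<and> r = p \<otimes>\<^bsub>GQ\<^esub> q" using \<pi>_in mult_GQ by auto
    next
      assume *: "p \<in> Q \<and> q \<in> Q \<and> r = p \<otimes>\<^bsub>GQ\<^esub> q"
      then obtain x y where "x \<in> carrier G" "y \<in> carrier G" "p = \<pi> x" "q = \<pi> y"
        using \<pi>_image by blast
      moreover then have "?B x y (x \<otimes> y) p q r" using * mult_GQ by simp
      ultimately show "?R p q r" using carrier_tuples m_closed by blast
    qed
    then have "{p @ q @ r |p q r. ?R p q r} =
        {p @ q @ r |p q r. p \<in> Q \<and> q \<in> Q \<and> r = p \<otimes>\<^bsub>GQ\<^esub> q}"
      by (simp only:)
    then show ?thesis by auto
  qed
  ultimately show ?thesis
    unfolding definable_group_def carrier_GQ using definable_Q group_GQ by simp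
qed

sublocale GQ: definable_group_over GQ M A k
  using definable_group_GQ group_GQ structure_M A_subset
  by (intro definable_group_over.intro definable_group_over_axioms.intro)

sublocale proj: definable_group_morphism G GQ M A n k \<pi>
  by unfold_locales (auto simp: \<pi>_hom \<pi>_Aut intro: definable_cochain_map[OF _ A_subset definable_\<pi>])

text \<open>
  If the image of \<open>\<Phi>\<close> in the quotient is the coboundary of \<open>\<pi>(b)\<close>, then twisting \<open>\<Phi>\<close> by \<open>b\<^sup>-\<^sup>1\<close> gives a
  cocycle that is trivial modulo \<open>N\<close>, so its values lie in \<open>N\<close>.
\<close>

lemma exact_at_H1_G:
  "exact_at (H1 M A (G\<lparr>carrier := N\<rparr>)) (H1_map M A G (\<lambda>x. x)) (H1 M A G)
     (H1_map M A GQ \<pi>) (H1 M A GQ)"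
proof -
  have "H1_map M A G (\<lambda>x. x) ` GN.cl ` GN.Z = {y \<in> cl ` Z. H1_map M A GQ \<pi> y = GQ.cl GQ.triv}"
  proof (intro Set.set_eqI iffI)
    fix y assume "y \<in> H1_map M A G (\<lambda>x. x) ` GN.cl ` GN.Z"
    then obtain \<Phi> where \<Phi>: "\<Phi> \<in> GN.Z" "y = H1_map M A G (\<lambda>x. x) (GN.cl \<Phi>)" by blast
    have y: "y = cl \<Phi>" unfolding \<Phi>(2) by (rule H1_map_incl[OF \<Phi>(1)])
    have Z: "\<Phi> \<in> Z" "\<Phi> \<in> Aut M A \<rightarrow> N" using GN_Z1_iff[THEN iffD1, OF \<Phi>(1)] by simp_all
    have "\<pi> (\<Phi> \<sigma>) = \<one>\<^bsub>GQ\<^esub>" if "\<sigma> \<in> Aut M A" for \<sigma>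
    proof -
      have "\<Phi> \<sigma> \<in> N" by (rule Pi_mem[OF Z(2) that])
      then have "\<pi> (\<Phi> \<sigma>) = \<pi> \<one>" using \<pi>_one_iff[OF N_carrier] by blast
      then show ?thesis by (simp only: one_GQ)
    qed
    then have "proj.push \<Phi> = GQ.triv" by (rule restrict_ext)
    then show "y \<in> {y \<in> cl ` Z. H1_map M A GQ \<pi> y = GQ.cl GQ.triv}"
      using Z(1) y proj.H1_map_class[OF Z(1)] by simp
  next
    fix y assume "y \<in> {y \<in> cl ` Z. H1_map M A GQ \<pi> y = GQ.cl GQ.triv}"
    then obtain \<Phi> where \<Phi>: "\<Phi> \<in> Z" "y = cl \<Phi>"
      and "H1_map M A GQ \<pi> (cl \<Phi>) = GQ.cl GQ.triv" by blast
    then have trivial: "GQ.cl (proj.push \<Phi>) = GQ.cl GQ.triv" by (simp only: proj.H1_map_class)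
    obtain q where q: "q \<in> Q"
      "\<And>\<sigma>. \<sigma> \<in> Aut M A \<Longrightarrow> \<pi> (\<Phi> \<sigma>) = inv\<^bsub>GQ\<^esub> q \<otimes>\<^bsub>GQ\<^esub> map \<sigma> q"
      using GQ.H1_class_trivial_iff[OF proj.push_in_Z1[OF \<Phi>(1)], THEN iffD1, OF trivial]
      unfolding carrier_GQ by auto
    obtain b where b: "b \<in> carrier G" "q = \<pi> b" using q(1) \<pi>_image by blast
    let ?c = "inv b"
    let ?\<Psi> = "\<lambda>\<sigma> \<in> Aut M A. inv ?c \<otimes> \<Phi> \<sigma> \<otimes> map \<sigma> ?c"
    have \<Psi>: "?\<Psi> \<in> Z" using twist_in_Z1[OF \<Phi>(1)] b(1) by blast
    have "?\<Psi> \<sigma> \<in> N" if \<sigma>: "\<sigma> \<in> Aut M A" for \<sigma>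
    proof -
      have in_G: "\<Phi> \<sigma> \<in> carrier G" "map \<sigma> b \<in> carrier G"
        using Z1_in[OF \<Phi>(1) \<sigma>] Aut_carrier[OF \<sigma> b(1)] by auto
      have "\<pi> (\<Phi> \<sigma>) = \<pi> (inv b \<otimes> map \<sigma> b)"
        using q(2)[OF \<sigma>] b in_G by (simp add: \<sigma> flip: \<pi>_Aut)
      then have "\<pi> (b \<otimes> \<Phi> \<sigma> \<otimes> inv (map \<sigma> b)) = \<pi> (b \<otimes> (inv b \<otimes> map \<sigma> b) \<otimes> inv (map \<sigma> b))"
        using b(1) in_G by simp
      also have "b \<otimes> (inv b \<otimes> map \<sigma> b) \<otimes> inv (map \<sigma> b) = \<one>"
        using b(1) in_G by (simp flip: m_assoc)
      finally have "b \<otimes> \<Phi> \<sigma> \<otimes> inv (map \<sigma> b) \<in> N"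
        using \<pi>_one_iff[of "b \<otimes> \<Phi> \<sigma> \<otimes> inv (map \<sigma> b)"] b(1) in_G by blast
      then show ?thesis using b(1) \<sigma> by (simp add: Aut_inv)
    qed
    then have \<Psi>_N: "?\<Psi> \<in> GN.Z" by (intro GN_Z1_iff[THEN iffD2] conjI \<Psi> Pi_I)
    have "(\<Phi>, ?\<Psi>) \<in> coh" unfolding coh_iff using \<Phi>(1) \<Psi> b(1)
      by (intro conjI bexI[of _ ?c] ballI) simp_all
    then have "y = cl ?\<Psi>" using H1_class_eq_iff[OF \<Phi>(1) \<Psi>] \<Phi>(2) by simp
    then have "y = H1_map M A G (\<lambda>x. x) (GN.cl ?\<Psi>)" by (simp only: H1_map_incl[OF \<Psi>_N])
    then show "y \<in> H1_map M A G (\<lambda>x. x) ` GN.cl ` GN.Z" using \<Psi>_N by blast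
  qed
  then show ?thesis
    unfolding exact_at_def GN.H1_eq H1_eq GQ.H1_eq fst_conv snd_conv
    by (intro conjI imageI GN.trivial_in_Z1 trivial_in_Z1 GQ.trivial_in_Z1
        incl.pointed_H1_map[unfolded GN.H1_eq H1_eq] proj.pointed_H1_map[unfolded GQ.H1_eq H1_eq])
qed

end

theorem theorem3p1:
  fixes M :: "('f, 'r, 'm) fo_structure" and A :: "'m set"
    and G :: "('m list) monoid" and N :: "'m list set" and n :: nat
  assumes "is_structure M" and "A \<subseteq> univ M"
    and "atomic_over M A" and "homogeneous_over M A" and "eliminates_imaginaries M"
    and "definable_group M A n G"
    and "subgroup N G" and "definable M A n N"
  shows "(\<exists>k Q \<pi>. is_coset_space M A n G N k Q \<pi>) \<and>
    (\<forall>k Q \<pi>. is_coset_space M A n G N k Q \<pi> \<longrightarrow>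
      (let GN = G\<lparr>carrier := N\<rparr>; GQ = quotient_group G Q \<pi>; \<iota> = (\<lambda>x. x);
           H0N = H0 M A N \<one>\<^bsub>G\<^esub>; H0G = H0 M A (carrier G) \<one>\<^bsub>G\<^esub>; H0Q = H0 M A Q (\<pi> \<one>\<^bsub>G\<^esub>);
           H1N = H1 M A GN; H1G = H1 M A G; H1Q = H1 M A GQ;
           \<iota>0 = H0_map M A N \<iota>; \<pi>0 = H0_map M A (carrier G) \<pi>;
           \<delta> = connecting_map M A G N \<pi>;
           \<iota>1 = H1_map M A G \<iota>; \<pi>1 = H1_map M A GQ \<pi>
       in exact_at ({()}, ()) (\<lambda>_. \<one>\<^bsub>G\<^esub>) H0N \<iota>0 H0G \<and>
          exact_at H0N \<iota>0 H0G \<pi>0 H0Q \<and>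
          exact_at H0G \<pi>0 H0Q \<delta> H1N \<and>
          exact_at H0Q \<delta> H1N \<iota>1 H1G \<and>
          (N \<lhd> G \<longrightarrow> definable_group M A k GQ \<and> exact_at H1N \<iota>1 H1G \<pi>1 H1Q)))"
proof -
  interpret definable_subgroup G M A n N
    using assms
    by (intro definable_subgroup.intro definable_group_over.intro definable_group_over_axioms.intro
        definable_subgroup_axioms.intro) (simp_all add: definable_group_def)
  show ?thesis
  proof (intro conjI allI impI)
    show "\<exists>k Q \<pi>. is_coset_space M A n G N k Q \<pi>" by (rule ex_coset_space[OF assms(5)])
  next
    fix k Q \<pi> assume "is_coset_space M A n G N k Q \<pi>"
    then interpret definable_coset_space G M A n N k Q \<pi> by unfold_locales
    have quotient: "definable_group M A k (quotient_group G Q \<pi>) \<and>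
        exact_at (H1 M A (G\<lparr>carrier := N\<rparr>)) (H1_map M A G (\<lambda>x. x)) (H1 M A G)
          (H1_map M A (quotient_group G Q \<pi>) \<pi>) (H1 M A (quotient_group G Q \<pi>))"
      if "N \<lhd> G"
    proof -
      interpret definable_quotient_group G M A n N k Q \<pi>
        using that by (intro definable_quotient_group.intro definable_quotient_group_axioms.intro
            definable_coset_space_axioms)
      show ?thesis using definable_group_GQ exact_at_H1_G by blast
    qed
    show "let GN = G\<lparr>carrier := N\<rparr>; GQ = quotient_group G Q \<pi>; \<iota> = (\<lambda>x. x);
           H0N = H0 M A N \<one>\<^bsub>G\<^esub>; H0G = H0 M A (carrier G) \<one>\<^bsub>G\<^esub>; H0Q = H0 M A Q (\<pi> \<one>\<^bsub>G\<^esub>);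
           H1N = H1 M A GN; H1G = H1 M A G; H1Q = H1 M A GQ;
           \<iota>0 = H0_map M A N \<iota>; \<pi>0 = H0_map M A (carrier G) \<pi>;
           \<delta> = connecting_map M A G N \<pi>;
           \<iota>1 = H1_map M A G \<iota>; \<pi>1 = H1_map M A GQ \<pi>
       in exact_at ({()}, ()) (\<lambda>_. \<one>\<^bsub>G\<^esub>) H0N \<iota>0 H0G \<and>
          exact_at H0N \<iota>0 H0G \<pi>0 H0Q \<and>
          exact_at H0G \<pi>0 H0Q \<delta> H1N \<and>
          exact_at H0Q \<delta> H1N \<iota>1 H1G \<and>
          (N \<lhd> G \<longrightarrow> definable_group M A k GQ \<and> exact_at H1N \<iota>1 H1G \<pi>1 H1Q)"
      unfolding Let_def
      by (intro conjI impI exact_at_H0_N exact_at_H0_G exact_at_H0_Q exact_at_H1_N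
          quotient[THEN conjunct1] quotient[THEN conjunct2])
  qed
qed

end
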